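(* Let $(W,S)$ be a finite Coxeter system, $Q=q_1\cdots q_m$ a non-empty word on $S$, $\rho\in W$, and let $Q_\vdash=q_2\cdots q_m$. Then the positive source tree $\mathcal P(Q,\rho)$ equals (i) $\mathcal P(Q_\vdash,q_1\rho)^{\rightarrow}$ if $1$ appears in none of the facets of $\mathcal{SC}(Q,\rho)$; (ii) $1\star\mathcal P(Q_\vdash,\rho)^{\rightarrow}$ if $1$ appears in all the facets of $\mathcal{SC}(Q,\rho)$; (iii) the disjoint union of $\mathcal P(Q_\vdash,q_1\rho)^{\rightarrow}$ and $1\star\mathcal P(Q_\vdash,\rho)^{\rightarrow}$, with an additional edge from $\mathsf P(Q,\rho)=\{1\}\cup\mathsf P(Q_\vdash,\rho)^{\rightarrow}$ to $\mathsf P(Q_\vdash,q_1\rho)^{\rightarrow}$, otherwise.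
   Context: Let $(W,S)$ be a finite Coxeter system with length function $\ell$. For a word $Q=q_1q_2\cdots q_m$ in the letters $S$ and $\rho\in W$, write $[m]=\{1,\dots,m\}$. The subword complex $\mathcal{SC}(Q,\rho)$ is the simplicial complex whose facets are the sets $I\subseteq[m]$ such that the letters of $Q$ at the positions in $[m]\setminus I$, read in increasing order of position, form a reduced expression of $\rho$. Positions in any word (in particular in $Q_\vdash$) are numbered from $1$. Two distinct facets $I,J$ are adjacent if $I\setminus\{i\}=J\setminus\{j\}$ for some $i\in I$, $j\in J$; the flip from $I$ to $J$ is increasing if $i<j$. The increasing flip graph $\mathcal G(Q,\rho)$ is the directed graph whose vertices are the facets and whose edges $I\to J$ are the increasing flips. For an edge $I\to J$ with $I\setminus\{i\}=J\setminus\{j\}$, $i<j$, set $\mathsf p(I\to J)=i$. A path is $\mathsf p$-rising if the sequence of $\mathsf p$-labels of its successive edges is strictly increasing. When $\mathcal{SC}(Q,\rho)$ is non-empty, the positive greedy facet $\mathsf P(Q,\rho)$ is the unique source of $\mathcal G(Q,\rho)$ (equivalently the lexicographically smallest facet), and the positive source tree $\mathcal P(Q,\rho)$ is the spanning tree of $\mathcal G(Q,\rho)$, directed away from $\mathsf P(Q,\rho)$, formed by all $\mathsf p$-rising paths from $\mathsf P(Q,\rho)$ to the facets of $\mathcal{SC}(Q,\rho)$ (there is exactly one such path to each facet). When $\mathcal{SC}(Q,\rho)$ has no facets, $\mathcal P(Q,\rho)$ is the empty tree. For $X\subseteq\mathbb Z$, $X^{\rightarrow}=\{x+1: x\in X\}$.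 For a directed tree $\mathcal T$ whose vertices are subsets of $\mathbb Z$, $\mathcal T^{\rightarrow}$ is the tree with vertices $X^{\rightarrow}$ for $X$ a vertex of $\mathcal T$ and edges $X^{\rightarrow}\to Y^{\rightarrow}$ for each edge $X\to Y$ of $\mathcal T$; and for $z\in\mathbb Z$, $z\star\mathcal T$ is the tree with vertices $X\cup\{z\}$ and edges $X\cup\{z\}\to Y\cup\{z\}$ for each vertex $X$ and edge $X\to Y$ of $\mathcal T$. *)

theory Defs
  imports "HOL-Algebra.Generated_Groups" "Graph_Theory.Pair_Digraph"
begin

section \<open>Coxeter systems\<close>

definition word_prod :: "('a, 'b) monoid_scheme \<Rightarrow> 'a list \<Rightarrow> 'a" where
  "word_prod W ws = foldr (\<lambda>x y. x \<otimes>\<^bsub>W\<^esub> y) ws \<one>\<^bsub>W\<^esub>"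

text \<open>The entry \<open>M s t = 0\<close> encodes \<open>m(s,t) = \<infinity>\<close>, that is, the absence of a relation.\<close>

definition coxeter_matrix :: "'a set \<Rightarrow> ('a \<Rightarrow> 'a \<Rightarrow> nat) \<Rightarrow> bool" where
  "coxeter_matrix S M \<longleftrightarrow>
     (\<forall>s\<in>S. \<forall>t\<in>S. M s t = M t s \<and> (M s t = 1 \<longleftrightarrow> s = t))"

text \<open>Deletion of one factor \<open>(s t)\<close> to the power \<open>M s t\<close> from a word on \<open>S\<close>.\<close>

inductive coxeter_step :: "'a set \<Rightarrow> ('a \<Rightarrow> 'a \<Rightarrow> nat) \<Rightarrow> 'a list \<Rightarrow> 'a list \<Rightarrow> bool"
  for S :: "'a set" and M :: "'a \<Rightarrow> 'a \<Rightarrow> nat" where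
  "\<lbrakk>u \<in> lists S; v \<in> lists S; s \<in> S; t \<in> S\<rbrakk>
     \<Longrightarrow> coxeter_step S M (u @ concat (replicate (M s t) [s, t]) @ v) (u @ v)"

text \<open>The last condition says that \<open>W\<close> is presented by the generators \<open>S\<close> and the relations
  \<open>(s t)\<^sup>m = 1\<close> with \<open>m = M s t\<close>. Since \<open>M s s = 1\<close> makes every generator its own inverse,
  no formal inverses are needed: words on \<open>S\<close> modulo insertion and deletion of the
  relators are the group with this presentation.\<close>

definition coxeter_system :: "('a, 'b) monoid_scheme \<Rightarrow> 'a set \<Rightarrow> bool" where
  "coxeter_system W S \<longleftrightarrow>
     group W \<and> S \<subseteq> carrier W \<and> generate W S = carrier W \<and>
     (\<exists>M. coxeter_matrix S M \<and>
        (\<forall>u\<in>lists S. \<forall>v\<in>lists S.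
           word_prod W u = word_prod W v \<longleftrightarrow> equivclp (coxeter_step S M) u v))"

definition finite_coxeter_system :: "('a, 'b) monoid_scheme \<Rightarrow> 'a set \<Rightarrow> bool" where
  "finite_coxeter_system W S \<longleftrightarrow> coxeter_system W S \<and> finite (carrier W)"

definition cox_length :: "('a, 'b) monoid_scheme \<Rightarrow> 'a set \<Rightarrow> 'a \<Rightarrow> nat" where
  "cox_length W S w = (LEAST n. \<exists>ws\<in>lists S. length ws = n \<and> word_prod W ws = w)"

definition reduced_expression :: "('a, 'b) monoid_scheme \<Rightarrow> 'a set \<Rightarrow> 'a list \<Rightarrow> 'a \<Rightarrow> bool" where
  "reduced_expression W S ws w \<longleftrightarrow>
     ws \<in> lists S \<and> word_prod W ws = w \<and> length ws = cox_length W S w"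

section \<open>Subword complexes\<close>

definition positions :: "'a list \<Rightarrow> int set" where
  "positions Q = {1..int (length Q)}"

text \<open>Positions start at 1, whereas \<open>nths\<close> counts from 0.\<close>

definition subword_at :: "'a list \<Rightarrow> int set \<Rightarrow> 'a list" where
  "subword_at Q X = nths Q {k. int k + 1 \<in> X}"

definition facets :: "('a, 'b) monoid_scheme \<Rightarrow> 'a set \<Rightarrow> 'a list \<Rightarrow> 'a \<Rightarrow> int set set" where
  "facets W S Q \<rho> =
     {I. I \<subseteq> positions Q \<and> reduced_expression W S (subword_at Q (positions Q - I)) \<rho>}"

section \<open>The increasing flip graph\<close>

definition increasing_flip :: "int set \<Rightarrow> int set \<Rightarrow> int \<Rightarrow> int \<Rightarrow> bool" where
  "increasing_flip I J i j \<longleftrightarrow> I \<noteq> J \<and> i \<in> I \<and> j \<in> J \<and> I - {i} = J - {j} \<and> i < j"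

definition flip_graph ::
  "('a, 'b) monoid_scheme \<Rightarrow> 'a set \<Rightarrow> 'a list \<Rightarrow> 'a \<Rightarrow> int set pair_pre_digraph" where
  "flip_graph W S Q \<rho> =
     \<lparr>pverts = facets W S Q \<rho>,
      parcs = {(I, J). I \<in> facets W S Q \<rho> \<and> J \<in> facets W S Q \<rho> \<and>
                       (\<exists>i j. increasing_flip I J i j)}\<rparr>"

definition p_label :: "int set \<times> int set \<Rightarrow> int" where
  "p_label e = (THE i. \<exists>j. increasing_flip (fst e) (snd e) i j)"

definition p_rising :: "(int set \<times> int set) list \<Rightarrow> bool" where
  "p_rising es \<longleftrightarrow> sorted_wrt (<) (map p_label es)"

text \<open>Meaningful only if there is at least one facet; then the source is unique.\<close>

definition positive_greedy_facet ::
  "('a, 'b) monoid_scheme \<Rightarrow> 'a set \<Rightarrow> 'a list \<Rightarrow> 'a \<Rightarrow> int set" where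
  "positive_greedy_facet W S Q \<rho> =
     (THE I. I \<in> pverts (flip_graph W S Q \<rho>) \<and>
             in_arcs (with_proj (flip_graph W S Q \<rho>)) I = {})"

text \<open>If there are no facets then \<open>apath\<close> holds for no path, so the result is the empty digraph.\<close>

definition positive_source_tree ::
  "('a, 'b) monoid_scheme \<Rightarrow> 'a set \<Rightarrow> 'a list \<Rightarrow> 'a \<Rightarrow> int set pair_pre_digraph" where
  "positive_source_tree W S Q \<rho> =
     \<lparr>pverts = facets W S Q \<rho>,
      parcs = \<Union>{set es | es J.
        pre_digraph.apath (with_proj (flip_graph W S Q \<rho>)) (positive_greedy_facet W S Q \<rho>) es J \<and>
        p_rising es}\<rparr>"

section \<open>Operations on trees of integer sets\<close>

definition shift :: "int set \<Rightarrow> int set" where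
  "shift X = (\<lambda>x. x + 1) ` X"

definition shift_tree :: "int set pair_pre_digraph \<Rightarrow> int set pair_pre_digraph" where
  "shift_tree T =
     \<lparr>pverts = shift ` pverts T, parcs = {(shift X, shift Y) | X Y. (X, Y) \<in> parcs T}\<rparr>"

definition join_tree :: "int \<Rightarrow> int set pair_pre_digraph \<Rightarrow> int set pair_pre_digraph"
  (infixr \<open>\<star>\<close> 70) where
  "z \<star> T =
     \<lparr>pverts = {X \<union> {z} | X. X \<in> pverts T},
      parcs = {(X \<union> {z}, Y \<union> {z}) | X Y. (X, Y) \<in> parcs T}\<rparr>"

end

theory Submission
  imports Defs
begin

text \<open>
  Splitting facets according to whether they contain the position 1 writes the facets of
  \<open>(q # Q, \<rho>)\<close> as shifted copies of those of \<open>(Q, \<rho>)\<close> and, if \<open>q\<close> is a left descent of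
  \<open>\<rho>\<close>, of \<open>(Q, q \<rho>)\<close>. A path with increasing labels can flip out the position 1 only in its
  first step, so it stays in the first part or jumps immediately to the second one. It remains
  to see that the jump ends at the greedy facet of \<open>(Q, q \<rho>)\<close>: scanning \<open>Q\<close> from right to
  left, the greedy facets of \<open>(Q, \<rho>)\<close> and \<open>(Q, q \<rho>)\<close> agree except at one position, where the
  remaining elements \<open>v\<close> and \<open>q v\<close> become equal by the exchange property. The latter
  is derived from the presentation by a parity count of reflections. Exchange is also what makes
  case (i) true when the subword complex is empty, since then \<open>(Q, q \<rho>)\<close> has no facets either.
\<close>

section \<open>The exchange property\<close>

lemma word_prod_Nil [simp]: "word_prod G [] = \<one>\<^bsub>G\<^esub>"
  by (simp add: word_prod_def)

lemma word_prod_Cons [simp]: "word_prod G (s # ws) = s \<otimes>\<^bsub>G\<^esub> word_prod G ws"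
  by (simp add: word_prod_def)

text \<open>For a word s_1 ... s_n of involutions this is the parity of the number of indices i with
  t = s_1 ... s_{i-1} s_i s_{i-1} ... s_1. The inequality of truth values serves as exclusive
  or.\<close>

primrec crosses :: "('a, 'b) monoid_scheme \<Rightarrow> 'a list \<Rightarrow> 'a \<Rightarrow> bool" where
  "crosses G [] t \<longleftrightarrow> False"
| "crosses G (s # ws) t \<longleftrightarrow> (t = s) \<noteq> crosses G ws (s \<otimes>\<^bsub>G\<^esub> t \<otimes>\<^bsub>G\<^esub> s)"

locale coxeter = group W for W :: "('a, 'b) monoid_scheme" (structure) +
  fixes S :: "'a set"
  assumes coxeter: "coxeter_system W S"
begin

lemmas [simp] = in_lists_conv_set

abbreviation len :: "'a \<Rightarrow> nat" where "len \<equiv> cox_length W S"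

lemma gen_closed: "s \<in> S \<Longrightarrow> s \<in> carrier W"
  using coxeter unfolding coxeter_system_def by blast

lemma word_prod_closed [simp]: "ws \<in> lists S \<Longrightarrow> word_prod W ws \<in> carrier W"
  by (induction ws) (auto simp: gen_closed)

lemma word_prod_append:
  "us \<in> lists S \<Longrightarrow> vs \<in> lists S \<Longrightarrow> word_prod W (us @ vs) = word_prod W us \<otimes> word_prod W vs"
  by (induction us) (auto simp: gen_closed m_assoc)

lemma concat_replicate_lists: "ws \<in> lists S \<Longrightarrow> concat (replicate n ws) \<in> lists S"
  by (induction n) auto

lemma word_prod_concat_replicate:
  "ws \<in> lists S \<Longrightarrow> word_prod W (concat (replicate n ws)) = word_prod W ws [^] n"
proof (induction n)
  case (Suc n)
  have "word_prod W (concat (replicate (Suc n) ws)) = word_prod W ws \<otimes> word_prod W ws [^] n"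
    using Suc by (simp add: word_prod_append concat_replicate_lists)
  also have "\<dots> = word_prod W ws [^] Suc n"
    using Suc.prems by (simp add: nat_pow_Suc2[symmetric] del: nat_pow_Suc)
  finally show ?case .
qed simp

text \<open>Each relator reduces to the empty word in one step and equivalent words have equal
  products, so the relators become equations in \<open>W\<close>.\<close>

lemma presentation:
  obtains M where "coxeter_matrix S M"
    and "\<And>u v. u \<in> lists S \<Longrightarrow> v \<in> lists S \<Longrightarrow>
      word_prod W u = word_prod W v \<longleftrightarrow> equivclp (coxeter_step S M) u v"
    and "\<And>s t. s \<in> S \<Longrightarrow> t \<in> S \<Longrightarrow> (s \<otimes> t) [^] M s t = \<one>"
proof -
  obtain M where M: "coxeter_matrix S M"
    and eq: "\<And>u v. u \<in> lists S \<Longrightarrow> v \<in> lists S \<Longrightarrow>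
      word_prod W u = word_prod W v \<longleftrightarrow> equivclp (coxeter_step S M) u v"
    using coxeter unfolding coxeter_system_def by blast
  have "(s \<otimes> t) [^] M s t = \<one>" if st: "s \<in> S" "t \<in> S" for s t
  proof -
    have L: "concat (replicate (M s t) [s, t]) \<in> lists S"
      using st by (intro concat_replicate_lists) auto
    have "coxeter_step S M ([] @ concat (replicate (M s t) [s, t]) @ []) ([] @ [])"
      using st by (intro coxeter_step.intros) auto
    then have "word_prod W (concat (replicate (M s t) [s, t])) = word_prod W []"
      using eq[OF L, of "[]"] by auto
    then show ?thesis
      using st by (subst (asm) word_prod_concat_replicate) (auto simp: gen_closed)
  qed
  with M eq show ?thesis using that by blast
qed

lemma gen_square [simp]: "s \<in> S \<Longrightarrow> s \<otimes> s = \<one>"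
proof (rule presentation)
  fix M assume "s \<in> S" "coxeter_matrix S M"
    and pow: "\<And>s t. s \<in> S \<Longrightarrow> t \<in> S \<Longrightarrow> (s \<otimes> t) [^] M s t = \<one>"
  then have "M s s = 1" by (auto simp: coxeter_matrix_def)
  with pow[of s s] \<open>s \<in> S\<close> show "s \<otimes> s = \<one>" by (simp add: gen_closed)
qed

lemma gen_cancel_left [simp]: "s \<in> S \<Longrightarrow> x \<in> carrier W \<Longrightarrow> s \<otimes> (s \<otimes> x) = x"
  by (simp add: gen_closed m_assoc[symmetric])

lemma gen_cancel_right [simp]: "s \<in> S \<Longrightarrow> x \<in> carrier W \<Longrightarrow> x \<otimes> s \<otimes> s = x"
  by (simp add: gen_closed m_assoc)

lemma inv_gen: "s \<in> S \<Longrightarrow> inv s = s"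
  by (rule inv_equality) (auto simp: gen_closed)

lemma word_prod_rev: "ws \<in> lists S \<Longrightarrow> word_prod W (rev ws) = inv (word_prod W ws)"
  by (induction ws) (auto simp: word_prod_append inv_mult_group gen_closed inv_gen)

lemma word_exists: "w \<in> carrier W \<Longrightarrow> \<exists>ws\<in>lists S. word_prod W ws = w"
proof -
  assume "w \<in> carrier W"
  then have "w \<in> generate W S" using coxeter unfolding coxeter_system_def by blast
  then show ?thesis
  proof induction
    case one
    show ?case by (intro bexI[of _ "[]"]) auto
  next
    case (incl h)
    then show ?case by (intro bexI[of _ "[h]"]) (auto simp: gen_closed)
  next
    case (inv h)
    then show ?case by (intro bexI[of _ "[h]"]) (auto simp: gen_closed inv_gen)
  next
    case (eng h1 h2)
    then obtain us vs where "us \<in> lists S" "word_prod W us = h1" "vs \<in> lists S" "word_prod W vs = h2"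
      by blast
    then show ?case by (intro bexI[of _ "us @ vs"]) (auto simp: word_prod_append)
  qed
qed

text \<open>Relators have even length, so a deletion step preserves the parity of the length; this
  is the sign character of \<open>W\<close>.\<close>

lemma length_word_even_iff:
  assumes "us \<in> lists S" "vs \<in> lists S" "word_prod W us = word_prod W vs"
  shows "even (length us) \<longleftrightarrow> even (length vs)"
proof (rule presentation)
  fix M :: "'a \<Rightarrow> 'a \<Rightarrow> nat"
  assume "\<And>u v. u \<in> lists S \<Longrightarrow> v \<in> lists S \<Longrightarrow>
      word_prod W u = word_prod W v \<longleftrightarrow> equivclp (coxeter_step S M) u v"
  then have "equivclp (coxeter_step S M) us vs" using assms by blast
  moreover have "even (length u) \<longleftrightarrow> even (length v)" if "coxeter_step S M u v" for u v
  proof -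
    have "even (length (concat (replicate n [s, t])))" for n and s t :: 'a
      by (induction n) auto
    with that show ?thesis by (cases) auto
  qed
  ultimately show ?thesis by induction auto
qed

section \<open>The length function\<close>

lemma len_word_le: "ws \<in> lists S \<Longrightarrow> len (word_prod W ws) \<le> length ws"
  unfolding cox_length_def by (rule Least_le) blast

lemma reduced_exists:
  assumes "w \<in> carrier W"
  obtains ws where "ws \<in> lists S" "word_prod W ws = w" "length ws = len w"
proof -
  have "\<exists>n. \<exists>ws\<in>lists S. length ws = n \<and> word_prod W ws = w"
    using word_exists[OF assms] by blast
  from LeastI_ex[OF this] show ?thesis using that unfolding cox_length_def by blast
qed

lemma len_inv: "w \<in> carrier W \<Longrightarrow> len (inv w) = len w"
proof -
  have le: "len (inv w) \<le> len w" if "w \<in> carrier W" for w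
  proof -
    obtain ws where "ws \<in> lists S" "word_prod W ws = w" "length ws = len w"
      using reduced_exists[OF \<open>w \<in> carrier W\<close>] .
    then show ?thesis using len_word_le[of "rev ws"] by (simp add: word_prod_rev)
  qed
  show "w \<in> carrier W \<Longrightarrow> len (inv w) = len w"
    using le[of w] le[of "inv w"] by simp
qed

text \<open>Prepending \<open>s\<close> raises the length by at most one. Applied to
  \<open>w\<close> and to \<open>s \<otimes> w\<close> this bounds the difference by one, and parity
  excludes equality.\<close>

lemma len_gen_mult:
  assumes "s \<in> S" "w \<in> carrier W"
  shows "len (s \<otimes> w) = Suc (len w) \<or> len w = Suc (len (s \<otimes> w))"
proof -
  have le: "len (s \<otimes> w) \<le> Suc (len w)" if "w \<in> carrier W" for w
  proof -
    obtain ws where "ws \<in> lists S" "word_prod W ws = w" "length ws = len w"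
      using reduced_exists[OF \<open>w \<in> carrier W\<close>] .
    then show ?thesis using len_word_le[of "s # ws"] assms by simp
  qed
  have sw: "s \<otimes> w \<in> carrier W" using assms by (simp add: gen_closed)
  obtain us where us: "us \<in> lists S" "word_prod W us = w" "length us = len w"
    using reduced_exists[OF \<open>w \<in> carrier W\<close>] .
  obtain vs where vs: "vs \<in> lists S" "word_prod W vs = s \<otimes> w" "length vs = len (s \<otimes> w)"
    using reduced_exists[OF sw] .
  have "even (length (s # us)) \<longleftrightarrow> even (length vs)"
    using us vs assms by (intro length_word_even_iff) auto
  then have "len (s \<otimes> w) \<noteq> len w" using us vs by auto
  moreover have "len w \<le> Suc (len (s \<otimes> w))" using le[OF sw] assms by simp
  ultimately show ?thesis using le[OF \<open>w \<in> carrier W\<close>] by linarith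
qed

lemma inv_gen_mult: "s \<in> S \<Longrightarrow> w \<in> carrier W \<Longrightarrow> inv (w \<otimes> s) = s \<otimes> inv w"
  by (simp add: inv_mult_group gen_closed inv_gen)

lemma len_mult_gen_inv: "s \<in> S \<Longrightarrow> w \<in> carrier W \<Longrightarrow> len (s \<otimes> inv w) = len (w \<otimes> s)"
  using len_inv[of "w \<otimes> s"] by (simp add: inv_gen_mult gen_closed)

lemma len_mult_gen:
  assumes "s \<in> S" "w \<in> carrier W"
  shows "len (w \<otimes> s) = Suc (len w) \<or> len w = Suc (len (w \<otimes> s))"
  using len_gen_mult[of s "inv w"] assms by (simp add: len_mult_gen_inv len_inv)

section \<open>Parity of wall crossings\<close>

lemma crosses_append:
  assumes "us \<in> lists S" "vs \<in> lists S" "t \<in> carrier W"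
  shows "crosses W (us @ vs) t \<longleftrightarrow>
    crosses W us t \<noteq> crosses W vs (word_prod W (rev us) \<otimes> t \<otimes> word_prod W us)"
  using assms
proof (induction us arbitrary: t)
  case (Cons s us)
  have [simp]: "s \<in> S" "s \<in> carrier W" "\<forall>x\<in>set us. x \<in> S"
    using Cons.hyps by (auto simp: gen_closed)
  have "crosses W ((s # us) @ vs) t \<longleftrightarrow> (t = s) \<noteq> (crosses W us (s \<otimes> t \<otimes> s) \<noteq>
      crosses W vs (word_prod W (rev us) \<otimes> (s \<otimes> t \<otimes> s) \<otimes> word_prod W us))"
    using Cons by (simp add: gen_closed)
  also have "word_prod W (rev us) \<otimes> (s \<otimes> t \<otimes> s) \<otimes> word_prod W us
      = word_prod W (rev (s # us)) \<otimes> t \<otimes> word_prod W (s # us)"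
    using Cons.prems by (simp add: word_prod_append m_assoc)
  finally show ?case by auto
qed auto

text \<open>The letter at index i of s t s t ..., counted from 0, contributes the reflection
  \<open>(s \<otimes> t) [^] i \<otimes> s\<close>; the sum counts the indices at which this is
  \<open>x\<close>.\<close>

lemma crosses_alternating:
  assumes "s \<in> S" "t \<in> S" "x \<in> carrier W"
  shows "crosses W (concat (replicate n [s, t])) x \<longleftrightarrow>
    odd (\<Sum>i<2 * n. of_bool (x = (s \<otimes> t) [^] i \<otimes> s) :: nat)"
  using assms(3)
proof (induction n arbitrary: x)
  case (Suc n)
  note [simp] = gen_closed[OF assms(1)] gen_closed[OF assms(2)]
  let ?f = "\<lambda>i::nat. (s \<otimes> t) [^] i \<otimes> s"
  have 1: "s \<otimes> x \<otimes> s = t \<longleftrightarrow> x = ?f 1"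
  proof -
    have "s \<otimes> (s \<otimes> x \<otimes> s) \<otimes> s = x" using assms Suc.prems by (simp add: m_assoc)
    moreover have "s \<otimes> ?f 1 \<otimes> s = t" using assms by (simp add: m_assoc)
    ultimately show ?thesis by auto
  qed
  \<comment> \<open>Conjugation by the first two letters lowers the exponent by two, which matches
    the remaining word with the tail of the sum.\<close>
  have 2: "t \<otimes> (s \<otimes> x \<otimes> s) \<otimes> t = ?f i \<longleftrightarrow> x = ?f (Suc (Suc i))" for i
  proof -
    have "t \<otimes> (s \<otimes> ?f (Suc (Suc i)) \<otimes> s) \<otimes> t = t \<otimes> s \<otimes> (s \<otimes> t) [^] Suc i \<otimes> s"
      using assms by (simp add: m_assoc)
    also have "\<dots> = t \<otimes> s \<otimes> (s \<otimes> t) \<otimes> (s \<otimes> t) [^] i \<otimes> s"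
      by (subst nat_pow_Suc2) (simp_all add: m_assoc)
    also have "\<dots> = ?f i" using assms by (simp add: m_assoc)
    finally have A: "t \<otimes> (s \<otimes> ?f (Suc (Suc i)) \<otimes> s) \<otimes> t = ?f i" .
    have B: "t \<otimes> (s \<otimes> x \<otimes> s) \<otimes> t = t \<otimes> (s \<otimes> y \<otimes> s) \<otimes> t \<longleftrightarrow> x = y" if "y \<in> carrier W" for y
      using that Suc.prems by simp
    show ?thesis using B[of "?f (Suc (Suc i))"] A by simp
  qed
  have "crosses W (concat (replicate (Suc n) [s, t])) x \<longleftrightarrow>
      (x = s) \<noteq> ((s \<otimes> x \<otimes> s = t) \<noteq>
        crosses W (concat (replicate n [s, t])) (t \<otimes> (s \<otimes> x \<otimes> s) \<otimes> t))"
    by simp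
  also have "\<dots> \<longleftrightarrow> (x = ?f 0) \<noteq> ((x = ?f 1) \<noteq>
      odd (\<Sum>i<2 * n. of_bool (x = ?f (Suc (Suc i))) :: nat))"
    using Suc.prems 2 by (subst Suc.IH) (auto simp: 1)
  also have "\<dots> \<longleftrightarrow> odd (\<Sum>i<Suc (Suc (2 * n)). of_bool (x = ?f i) :: nat)"
    by (simp only: sum.lessThan_Suc_shift even_add) auto
  finally show ?case by simp
qed auto

text \<open>The sequence of contributed reflections has period n, so its 2 n terms meet
  \<open>x\<close> an even number of times.\<close>

lemma crosses_relator:
  assumes "s \<in> S" "t \<in> S" "x \<in> carrier W" "(s \<otimes> t) [^] n = \<one>"
  shows "\<not> crosses W (concat (replicate n [s, t])) x"
proof -
  let ?g = "\<lambda>i::nat. of_bool (x = (s \<otimes> t) [^] i \<otimes> s) :: nat"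
  have periodic: "?g (i + n) = ?g i" for i
    using assms by (simp add: nat_pow_mult[symmetric] gen_closed)
  have "(\<Sum>i<n + n. ?g i) = (\<Sum>i<n. ?g i) + (\<Sum>i\<in>{0 + n..<n + n}. ?g i)"
    by (simp only: lessThan_atLeast0 add_0 sum.atLeastLessThan_concat le_add1 zero_le)
  also have "(\<Sum>i\<in>{0 + n..<n + n}. ?g i) = (\<Sum>i<n. ?g i)"
    by (simp only: sum.shift_bounds_nat_ivl periodic lessThan_atLeast0)
  finally have "even (\<Sum>i<2 * n. ?g i)" by (simp add: mult_2)
  then show ?thesis using assms crosses_alternating by simp
qed

text \<open>The parity of the number of times a word crosses the wall of \<open>t\<close> depends only on the
  group element; this replaces the root system in the proof of the exchange property.\<close>

lemma crosses_cong:
  assumes "us \<in> lists S" "vs \<in> lists S" "word_prod W us = word_prod W vs" "x \<in> carrier W"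
  shows "crosses W us x \<longleftrightarrow> crosses W vs x"
proof (rule presentation)
  fix M :: "'a \<Rightarrow> 'a \<Rightarrow> nat"
  assume pow: "\<And>s t. s \<in> S \<Longrightarrow> t \<in> S \<Longrightarrow> (s \<otimes> t) [^] M s t = \<one>"
  assume "\<And>u v. u \<in> lists S \<Longrightarrow> v \<in> lists S \<Longrightarrow>
      word_prod W u = word_prod W v \<longleftrightarrow> equivclp (coxeter_step S M) u v"
  then have "equivclp (coxeter_step S M) us vs" using assms by blast
  moreover have "crosses W u x \<longleftrightarrow> crosses W v x" if "coxeter_step S M u v" for u v
    using that
  proof cases
    case (1 a b s t)
    let ?r = "concat (replicate (M s t) [s, t])"
    have r: "?r \<in> lists S" using 1 by (intro concat_replicate_lists) auto
    \<comment> \<open>As the relator has trivial product, the letters after it test the same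
      conjugate of \<open>x\<close> as before; the relator itself contributes an even count.\<close>
    have "word_prod W ?r = \<one>"
      using 1 pow[of s t] by (subst word_prod_concat_replicate) (auto simp: gen_closed)
    moreover from this have "word_prod W (rev ?r) = \<one>"
      using r by (simp add: word_prod_rev del: rev_concat)
    moreover have "\<not> crosses W ?r y" if "y \<in> carrier W" for y
      using 1 pow that by (intro crosses_relator) auto
    ultimately show ?thesis
      using 1 r assms(4) by (simp add: crosses_append del: rev_concat)
  qed
  ultimately show ?thesis by induction auto
qed

text \<open>An odd count is positive, so some letter s_i satisfies x = s_1 ... s_i ... s_1;
  multiplying by this element from the left deletes s_i.\<close>

lemma delete_letter_if_crosses:
  assumes "ws \<in> lists S" "crosses W ws x" "x \<in> carrier W"
  shows "\<exists>i<length ws. word_prod W (take i ws @ drop (Suc i) ws) = x \<otimes> word_prod W ws"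
  using assms
proof (induction ws arbitrary: x)
  case (Cons s ws)
  show ?case
  proof (cases "x = s")
    case True
    show ?thesis using True Cons.hyps by (intro exI[of _ 0]) auto
  next
    case False
    then have "crosses W ws (s \<otimes> x \<otimes> s)" "s \<otimes> x \<otimes> s \<in> carrier W"
      using Cons.hyps Cons.prems by (auto simp: gen_closed)
    from Cons.IH[OF this] obtain i where i: "i < length ws"
      "word_prod W (take i ws @ drop (Suc i) ws) = s \<otimes> x \<otimes> s \<otimes> word_prod W ws"
      by blast
    then show ?thesis
      using Cons.hyps Cons.prems by (intro exI[of _ "Suc i"]) (auto simp: m_assoc gen_closed)
  qed
qed auto

section \<open>Exchange on both sides\<close>

text \<open>It suffices that \<open>ws\<close> crosses \<open>s\<close>. Otherwise take a reduced
  word \<open>us\<close> of \<open>s \<otimes> word_prod W ws\<close>. Since \<open>s # us\<close>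
  and \<open>ws\<close> have the same product, \<open>us\<close> crosses \<open>s\<close>, and
  deleting a letter of \<open>us\<close> gives a word for \<open>word_prod W ws\<close> that is too
  short.\<close>

lemma exchange_left:
  assumes "ws \<in> lists S" "s \<in> S" "len (s \<otimes> word_prod W ws) < len (word_prod W ws)"
  shows "\<exists>i<length ws. word_prod W (take i ws @ drop (Suc i) ws) = s \<otimes> word_prod W ws"
proof (rule delete_letter_if_crosses)
  note [simp] = gen_closed[OF \<open>s \<in> S\<close>]
  show "crosses W ws s"
  proof (rule ccontr)
    assume no: "\<not> crosses W ws s"
    have "s \<otimes> word_prod W ws \<in> carrier W" using assms by simp
    then obtain us where us: "us \<in> lists S" "word_prod W us = s \<otimes> word_prod W ws"
      "length us = len (s \<otimes> word_prod W ws)"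
      using reduced_exists by metis
    have "crosses W (s # us) s \<longleftrightarrow> crosses W ws s"
      using us assms by (intro crosses_cong) auto
    \<comment> \<open>The first letter of \<open>s # us\<close> is itself a crossing of
      \<open>s\<close>, and conjugating \<open>s\<close> by \<open>s\<close> changes nothing, so
      \<open>us\<close> has the opposite parity.\<close>
    then have "crosses W us s" using no assms by simp
    from delete_letter_if_crosses[OF us(1) this] obtain i where
      i: "i < length us" "word_prod W (take i us @ drop (Suc i) us) = word_prod W ws"
      using us assms by auto
    have "take i us @ drop (Suc i) us \<in> lists S"
      using us by (auto dest: in_set_takeD in_set_dropD)
    from len_word_le[OF this] i us assms show False by simp
  qed
qed (use assms gen_closed in auto)

text \<open>The left version applies to the reversed word, which represents the inverse.\<close>

lemma exchange_right:
  assumes "ws \<in> lists S" "s \<in> S" "len (word_prod W ws \<otimes> s) < len (word_prod W ws)"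
  shows "\<exists>i<length ws. word_prod W (take i ws @ drop (Suc i) ws) = word_prod W ws \<otimes> s"
proof -
  let ?w = "word_prod W ws"
  have "len (s \<otimes> word_prod W (rev ws)) < len (word_prod W (rev ws))"
    using assms by (simp add: word_prod_rev len_mult_gen_inv len_inv)
  from exchange_left[OF _ _ this] obtain i where i: "i < length ws"
    "word_prod W (take i (rev ws) @ drop (Suc i) (rev ws)) = s \<otimes> inv ?w"
    using assms by (auto simp: word_prod_rev)
  \<comment> \<open>Index i of the reversed word is index \<open>length ws - Suc i\<close> of
    \<open>ws\<close>.\<close>
  define j where "j = length ws - Suc i"
  have "take i (rev ws) @ drop (Suc i) (rev ws) = rev (take j ws @ drop (Suc j) ws)"
    using i(1) by (simp add: take_rev drop_rev j_def Suc_diff_Suc)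
  moreover have L: "take j ws @ drop (Suc j) ws \<in> lists S"
    using assms by (auto dest: in_set_takeD in_set_dropD)
  ultimately have "inv (word_prod W (take j ws @ drop (Suc j) ws)) = inv (?w \<otimes> s)"
    using i assms by (simp only: word_prod_rev inv_gen_mult word_prod_closed)
  moreover have "word_prod W (take j ws @ drop (Suc j) ws) \<in> carrier W"
    using L by (rule word_prod_closed)
  ultimately have "word_prod W (take j ws @ drop (Suc j) ws) = ?w \<otimes> s"
    using assms by (metis inv_inv m_closed gen_closed word_prod_closed)
  then show ?thesis using i by (intro exI[of _ j]) (auto simp: j_def)
qed

text \<open>Put \<open>q\<close> in front of a reduced word \<open>us\<close> of
  \<open>q \<otimes> v\<close> and exchange with \<open>s\<close> on the right. If the deleted
  letter were in \<open>us\<close>, then \<open>q \<otimes> v \<otimes> s\<close> would be shorter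
  than \<open>q \<otimes> v\<close>; so it is the leading \<open>q\<close>.\<close>

lemma two_sided_descent:
  assumes "v \<in> carrier W" "q \<in> S" "s \<in> S" "len (q \<otimes> v) < len v" "len (v \<otimes> s) < len v"
    and "\<not> len (q \<otimes> v \<otimes> s) < len (q \<otimes> v)"
  shows "v \<otimes> s = q \<otimes> v"
proof -
  note [simp] = gen_closed[OF \<open>s \<in> S\<close>] gen_closed[OF \<open>q \<in> S\<close>]
  obtain us where us: "us \<in> lists S" "word_prod W us = q \<otimes> v" "length us = len (q \<otimes> v)"
    using assms reduced_exists[of "q \<otimes> v"] by auto
  have v: "word_prod W (q # us) = v" using us assms by simp
  from exchange_right[of "q # us" s] obtain i where
    i: "i < Suc (length us)" "word_prod W (take i (q # us) @ drop (Suc i) (q # us)) = v \<otimes> s"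
    unfolding v using us assms by auto
  show ?thesis
  proof (cases i)
    case 0
    with i us show ?thesis by simp
  next
    case (Suc j)
    have L: "take j us @ drop (Suc j) us \<in> lists S"
      using us by (auto dest: in_set_takeD in_set_dropD)
    have "q \<otimes> (v \<otimes> s) = word_prod W (take j us @ drop (Suc j) us)"
      using i L assms Suc by (simp flip: i(2))
    with len_word_le[OF L] i Suc us assms show ?thesis by (simp add: m_assoc)
  qed
qed

end

section \<open>Facets and sources of the flip graph\<close>

lemma mem_shift [simp]: "x \<in> shift X \<longleftrightarrow> x - 1 \<in> X"
  by (auto simp: shift_def image_iff) (metis diff_add_cancel)

lemma inj_shift: "inj shift"
  unfolding shift_def by (rule injI) (simp add: inj_image_eq_iff)

abbreviation shift_cone :: "int set \<Rightarrow> int set" where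
  "shift_cone X \<equiv> insert 1 (shift X)"

text \<open>If 0 were in a set, its shift would already contain 1 and the inserted 1 would hide
  this. Facets avoid 0 since positions start at 1.\<close>

lemma shift_cone_eq_iff: "0 \<notin> X \<Longrightarrow> 0 \<notin> Y \<Longrightarrow> shift_cone X = shift_cone Y \<longleftrightarrow> X = Y"
  by (subst insert_ident) (auto simp: inj_eq[OF inj_shift])

section \<open>Positions and subwords\<close>

lemma positions_Nil [simp]: "positions [] = {}"
  by (simp add: positions_def)

lemma mem_positions: "x \<in> positions Q \<longleftrightarrow> 1 \<le> x \<and> x \<le> int (length Q)"
  by (simp add: positions_def)

lemma positions_snoc: "positions (Q @ [s]) = insert (int (length Q) + 1) (positions Q)"
  by (auto simp: mem_positions)

lemma subword_at_Cons:
  "subword_at (q # Q) X = (if 1 \<in> X then [q] else []) @ subword_at Q {x. x + 1 \<in> X}"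
  by (simp add: subword_at_def nths_Cons algebra_simps)

lemma subword_at_snoc:
  "subword_at (Q @ [s]) X = subword_at Q X @ (if int (length Q) + 1 \<in> X then [s] else [])"
  by (simp add: subword_at_def nths_append)

lemma subword_at_Nil [simp]: "subword_at [] X = []"
  by (simp add: subword_at_def)

lemma subword_at_cong:
  "(\<And>x. x \<in> positions Q \<Longrightarrow> x \<in> X \<longleftrightarrow> x \<in> Y) \<Longrightarrow> subword_at Q X = subword_at Q Y"
proof (induction Q arbitrary: X Y)
  case (Cons q Q)
  have "subword_at Q {x. x + 1 \<in> X} = subword_at Q {x. x + 1 \<in> Y}"
    using Cons.prems by (intro Cons.IH) (auto simp: mem_positions)
  moreover have "1 \<in> X \<longleftrightarrow> 1 \<in> Y" using Cons.prems by (auto simp: mem_positions)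
  ultimately show ?case by (simp add: subword_at_Cons)
qed simp

lemma subword_at_lists: "set Q \<subseteq> S \<Longrightarrow> subword_at Q X \<in> lists S"
  by (auto simp: subword_at_def dest: in_set_nthsD)

text \<open>Translates a list index, as delivered by the exchange property, into the position of
  \<open>Q\<close> that has to be removed.\<close>

lemma subword_at_delete:
  assumes "i < length (subword_at Q X)"
  shows "\<exists>j\<in>X \<inter> positions Q. subword_at Q (X - {j}) =
    take i (subword_at Q X) @ drop (Suc i) (subword_at Q X)"
  using assms
proof (induction Q arbitrary: X i)
  case (Cons q Q)
  let ?X = "{x. x + 1 \<in> X}"
  show ?case
  proof (cases "1 \<in> X \<and> i = 0")
    case True
    have "subword_at Q {x. x + 1 \<in> X - {1}} = subword_at Q ?X"
      by (rule subword_at_cong) (auto simp: mem_positions)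
    with True show ?thesis
      by (intro bexI[of _ 1]) (auto simp: subword_at_Cons mem_positions)
  next
    case False
    \<comment> \<open>When 1 is in \<open>X\<close>, the letter \<open>q\<close> occupies index 0 of
      the subword, so indices in the tail are one lower.\<close>
    define k where "k = (if 1 \<in> X then i - 1 else i)"
    have "k < length (subword_at Q ?X)"
      using Cons.prems False by (auto simp: subword_at_Cons k_def)
    then obtain j where j: "j \<in> ?X \<inter> positions Q"
      "subword_at Q (?X - {j}) = take k (subword_at Q ?X) @ drop (Suc k) (subword_at Q ?X)"
      using Cons.IH by blast
    have "{x. x + 1 \<in> X - {j + 1}} = ?X - {j}" by auto
    with j False show ?thesis
      by (intro bexI[of _ "j + 1"]; cases i) (auto simp: subword_at_Cons k_def mem_positions)
  qed
qed simp

section \<open>Increasing flips\<close>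

definition flips_up :: "int set \<Rightarrow> int set \<Rightarrow> bool" where
  "flips_up X Y \<longleftrightarrow> (\<exists>i j. increasing_flip X Y i j)"

text \<open>Since i and j differ, a j in \<open>X\<close> would survive in \<open>X - {i}\<close>,
  which equals \<open>Y - {j}\<close>.\<close>

lemma increasing_flip_iff:
  "increasing_flip X Y i j \<longleftrightarrow> i < j \<and> i \<in> X \<and> j \<notin> X \<and> Y = insert j (X - {i})"
  unfolding increasing_flip_def by auto

text \<open>The label is the only element of \<open>X\<close> missing from \<open>Y\<close>, so the
  definite description is well defined.\<close>

lemma p_label_eq: "increasing_flip X Y i j \<Longrightarrow> p_label (X, Y) = i"
  unfolding p_label_def by (rule the_equality) (auto simp: increasing_flip_iff)

lemma increasing_flip_shift:
  "increasing_flip (shift X) (shift Y) i j \<longleftrightarrow> increasing_flip X Y (i - 1) (j - 1)"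
proof -
  have "insert j (shift X - {i}) = shift (insert (j - 1) (X - {i - 1}))" by auto
  then show ?thesis by (simp add: increasing_flip_iff inj_eq[OF inj_shift])
qed

text \<open>The position 1 lies in both cones and takes no part in a flip; the assumptions on 0
  exclude the corresponding flips of \<open>X\<close> and \<open>Y\<close>.\<close>

lemma increasing_flip_shift_cone:
  assumes "0 \<notin> X" "0 \<notin> Y"
  shows "increasing_flip (shift_cone X) (shift_cone Y) i j \<longleftrightarrow> increasing_flip X Y (i - 1) (j - 1)"
proof (cases "i = 1 \<or> j = 1")
  case True
  then show ?thesis using assms by (auto simp: increasing_flip_iff)
next
  case False
  let ?Z = "insert (j - 1) (X - {i - 1})"
  have *: "insert j (shift_cone X - {i}) = shift_cone ?Z" using False by auto
  have "0 \<notin> ?Z" using assms False by auto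
  then have "shift_cone Y = insert j (shift_cone X - {i}) \<longleftrightarrow> Y = ?Z"
    unfolding * using assms by (intro shift_cone_eq_iff)
  then show ?thesis using False by (simp add: increasing_flip_iff)
qed

text \<open>The sum is a potential on the flip graph: a facet of minimal sum is a source, and no
  walk repeats a vertex.\<close>

lemma sum_less_if_flips_up:
  assumes "flips_up X Y" "finite X"
  shows "\<Sum>X < \<Sum>Y"
proof -
  obtain i j where "i < j" "i \<in> X" "j \<notin> X" "Y = insert j (X - {i})"
    using assms by (auto simp: flips_up_def increasing_flip_iff)
  then show ?thesis using assms by (simp add: sum_diff1)
qed

section \<open>Facets and sources\<close>

lemma finite_facet: "I \<in> facets G S Q \<rho> \<Longrightarrow> finite I"
  by (auto simp: facets_def positions_def intro: finite_subset)

lemma facet_subset: "I \<in> facets G S Q \<rho> \<Longrightarrow> I \<subseteq> positions Q"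
  by (simp add: facets_def)

lemma facet_ge_1: "I \<in> facets G S Q \<rho> \<Longrightarrow> x \<in> I \<Longrightarrow> 1 \<le> x"
  using facet_subset[of I G S Q \<rho>] by (auto simp: mem_positions)

lemma finite_facets: "finite (facets G S Q \<rho>)"
  by (rule finite_subset[of _ "Pow (positions Q)"]) (auto simp: facets_def positions_def)

text \<open>A predicate form of the greedy facet, usable before uniqueness is known;
  \<open>greedy_eq_source\<close> connects it to the definite description.\<close>

definition source :: "('a, 'b) monoid_scheme \<Rightarrow> 'a set \<Rightarrow> 'a list \<Rightarrow> 'a \<Rightarrow> int set \<Rightarrow> bool" where
  "source G S Q \<rho> I \<longleftrightarrow> I \<in> facets G S Q \<rho> \<and> (\<forall>J\<in>facets G S Q \<rho>. \<not> flips_up J I)"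

lemma source_exists:
  assumes "facets G S Q \<rho> \<noteq> {}"
  shows "\<exists>I. source G S Q \<rho> I"
proof -
  obtain I where I: "I \<in> facets G S Q \<rho>" "\<And>J. J \<in> facets G S Q \<rho> \<Longrightarrow> \<not> \<Sum>J < \<Sum>I"
    using ex_min_if_finite[of "(\<lambda>I. \<Sum>I) ` facets G S Q \<rho>"] assms finite_facets[of G S Q \<rho>]
    by auto
  then have "source G S Q \<rho> I"
    unfolding source_def using sum_less_if_flips_up finite_facet by metis
  then show ?thesis ..
qed

section \<open>Splitting off the first or the last letter\<close>

context coxeter
begin

text \<open>Multiplication by \<open>q\<close> changes the length by exactly one, and a word for
  \<open>q \<otimes> \<rho>\<close> with one letter less than \<open>len \<rho>\<close> is
  compatible only with a decrease.\<close>

lemma reduced_Cons_iff: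
  assumes "q \<in> S" "ws \<in> lists S" "\<rho> \<in> carrier W"
  shows "reduced_expression W S (q # ws) \<rho> \<longleftrightarrow>
    reduced_expression W S ws (q \<otimes> \<rho>) \<and> len (q \<otimes> \<rho>) < len \<rho>"
proof -
  have "q \<otimes> word_prod W ws = \<rho> \<longleftrightarrow> word_prod W ws = q \<otimes> \<rho>"
    using assms by auto
  then show ?thesis
    using len_gen_mult[of q \<rho>] len_word_le[of ws] assms
    by (auto simp: reduced_expression_def)
qed

lemma reduced_snoc_iff:
  assumes "s \<in> S" "ws \<in> lists S" "\<rho> \<in> carrier W"
  shows "reduced_expression W S (ws @ [s]) \<rho> \<longleftrightarrow>
    reduced_expression W S ws (\<rho> \<otimes> s) \<and> len (\<rho> \<otimes> s) < len \<rho>"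
proof -
  have "word_prod W (ws @ [s]) = \<rho> \<longleftrightarrow> word_prod W ws = \<rho> \<otimes> s"
    using assms by (auto simp: word_prod_append gen_closed)
  then show ?thesis
    using len_mult_gen[of s \<rho>] len_word_le[of ws] assms
    by (auto simp: reduced_expression_def)
qed

lemma facets_Cons_shift_cone_iff:
  assumes "X \<subseteq> positions Q"
  shows "shift_cone X \<in> facets W S (q # Q) \<rho> \<longleftrightarrow> X \<in> facets W S Q \<rho>"
proof -
  have "subword_at Q {x. x + 1 \<in> positions (q # Q) - shift_cone X} = subword_at Q (positions Q - X)"
    by (rule subword_at_cong) (auto simp: mem_positions)
  moreover have "shift_cone X \<subseteq> positions (q # Q)"
    using assms by (auto simp: mem_positions dest!: subsetD)
  ultimately show ?thesis using assms by (simp add: facets_def subword_at_Cons)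
qed

lemma facets_Cons_shift_iff:
  assumes "X \<subseteq> positions Q" "q \<in> S" "set Q \<subseteq> S" "\<rho> \<in> carrier W"
  shows "shift X \<in> facets W S (q # Q) \<rho> \<longleftrightarrow> X \<in> facets W S Q (q \<otimes> \<rho>) \<and> len (q \<otimes> \<rho>) < len \<rho>"
proof -
  have "subword_at Q {x. x + 1 \<in> positions (q # Q) - shift X} = subword_at Q (positions Q - X)"
    by (rule subword_at_cong) (auto simp: mem_positions)
  moreover have "shift X \<subseteq> positions (q # Q)" "0 \<notin> X"
    using assms by (auto simp: mem_positions dest!: subsetD)
  ultimately show ?thesis
    using assms reduced_Cons_iff[OF _ subword_at_lists]
    by (simp add: facets_def subword_at_Cons mem_positions)
qed

text \<open>A facet with 1 leaves \<open>q\<close> out of the expression; a facet without 1 uses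
  \<open>q\<close> as first letter, which forces \<open>q\<close> to be a left descent of
  \<rho>.\<close>

lemma facets_Cons:
  assumes "q \<in> S" "set Q \<subseteq> S" "\<rho> \<in> carrier W"
  shows "{I \<in> facets W S (q # Q) \<rho>. 1 \<in> I} = shift_cone ` facets W S Q \<rho>"
    and "{I \<in> facets W S (q # Q) \<rho>. 1 \<notin> I} =
      (if len (q \<otimes> \<rho>) < len \<rho> then shift ` facets W S Q (q \<otimes> \<rho>) else {})"
proof -
  have *: "\<exists>X\<subseteq>positions Q. I = (if 1 \<in> I then shift_cone X else shift X)"
    if "I \<in> facets W S (q # Q) \<rho>" for I
  proof -
    let ?X = "{x \<in> positions Q. x + 1 \<in> I}"
    have b: "1 \<le> x \<and> x \<le> int (length Q) + 1" if "x \<in> I" for x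
      using facet_subset[OF \<open>I \<in> _\<close>] that by (auto simp: mem_positions dest!: subsetD)
    have "x \<in> I \<longleftrightarrow> x \<in> (if 1 \<in> I then shift_cone ?X else shift ?X)" for x
      using b[of x] by (cases "x = 1") (auto simp: mem_positions)
    then show ?thesis by (intro exI[of _ ?X]) blast
  qed
  have 0: "0 \<notin> X" if "X \<in> facets W S Q w" for X w
    using facet_subset[OF that] by (auto simp: mem_positions dest!: subsetD)
  show "{I \<in> facets W S (q # Q) \<rho>. 1 \<in> I} = shift_cone ` facets W S Q \<rho>"
  proof (intro equalityI subsetI)
    fix I assume I: "I \<in> {I \<in> facets W S (q # Q) \<rho>. 1 \<in> I}"
    then obtain X where "X \<subseteq> positions Q" "I = shift_cone X" using *[of I] by auto
    then show "I \<in> shift_cone ` facets W S Q \<rho>"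
      using I facets_Cons_shift_cone_iff[of X Q q \<rho>] by blast
  next
    fix I assume "I \<in> shift_cone ` facets W S Q \<rho>"
    then obtain X where "X \<in> facets W S Q \<rho>" "I = shift_cone X" by blast
    then show "I \<in> {I \<in> facets W S (q # Q) \<rho>. 1 \<in> I}"
      using facets_Cons_shift_cone_iff[OF facet_subset] by blast
  qed
  show "{I \<in> facets W S (q # Q) \<rho>. 1 \<notin> I} =
      (if len (q \<otimes> \<rho>) < len \<rho> then shift ` facets W S Q (q \<otimes> \<rho>) else {})" (is "_ = ?R")
  proof (intro equalityI subsetI)
    fix I assume I: "I \<in> {I \<in> facets W S (q # Q) \<rho>. 1 \<notin> I}"
    then obtain X where "X \<subseteq> positions Q" "I = shift X" using *[of I] by auto
    then show "I \<in> ?R"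
      using I facets_Cons_shift_iff[of X Q q \<rho>] assms by auto
  next
    fix I assume "I \<in> ?R"
    then obtain X where X: "X \<in> facets W S Q (q \<otimes> \<rho>)" "I = shift X" "len (q \<otimes> \<rho>) < len \<rho>"
      by (auto split: if_splits)
    then have "I \<in> facets W S (q # Q) \<rho>"
      using facets_Cons_shift_iff[OF facet_subset assms] by blast
    then show "I \<in> {I \<in> facets W S (q # Q) \<rho>. 1 \<notin> I}" using 0 X by simp
  qed
qed

text \<open>Mirror image of \<open>facets_Cons\<close>: the earlier positions keep their numbers, so
  no shift occurs. It drives the inductions from the right end.\<close>

lemma facets_snoc_iff:
  assumes "s \<in> S" "set Q \<subseteq> S" "\<rho> \<in> carrier W"
  defines "m \<equiv> int (length Q) + 1"
  shows "I \<in> facets W S (Q @ [s]) \<rho> \<longleftrightarrow>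
    (if m \<in> I then I - {m} \<in> facets W S Q \<rho>
     else I \<in> facets W S Q (\<rho> \<otimes> s) \<and> len (\<rho> \<otimes> s) < len \<rho>)"
proof -
  have sub: "I \<subseteq> positions (Q @ [s]) \<longleftrightarrow> I - {m} \<subseteq> positions Q"
    by (auto simp: positions_snoc m_def)
  have "subword_at Q (positions (Q @ [s]) - I) = subword_at Q (positions Q - (I - {m}))"
    by (rule subword_at_cong) (auto simp: mem_positions m_def)
  then have word: "subword_at (Q @ [s]) (positions (Q @ [s]) - I) =
      subword_at Q (positions Q - (I - {m})) @ (if m \<in> I then [] else [s])"
    by (simp add: subword_at_snoc positions_snoc m_def)
  show ?thesis
  proof (cases "m \<in> I")
    case True
    then show ?thesis by (simp add: facets_def sub word)
  next
    case False
    then show ?thesis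
      using reduced_snoc_iff[OF assms(1) subword_at_lists[OF assms(2)] assms(3)]
      by (simp add: facets_def sub word)
  qed
qed

section \<open>Exchange for facets\<close>

text \<open>Deleting a letter of the complementary word adds its position to the facet. The new word
  is reduced because its length drops by one together with the length of the element.\<close>

lemma facet_insert_exists:
  assumes "I \<in> facets W S Q w" "set Q \<subseteq> S"
    and "i < length (subword_at Q (positions Q - I))"
    and "word_prod W (take i (subword_at Q (positions Q - I)) @
      drop (Suc i) (subword_at Q (positions Q - I))) = v"
    and "len w = Suc (len v)"
  shows "\<exists>j\<in>positions Q - I. insert j I \<in> facets W S Q v"
proof -
  let ?ws = "subword_at Q (positions Q - I)"
  have I: "I \<subseteq> positions Q" and ws: "length ?ws = len w"
    using assms(1) by (simp_all add: facets_def reduced_expression_def)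
  obtain j where j: "j \<in> positions Q - I"
    "subword_at Q (positions Q - I - {j}) = take i ?ws @ drop (Suc i) ?ws"
    using subword_at_delete[OF assms(3)] by blast
  have "length (take i ?ws @ drop (Suc i) ?ws) = len v"
    using assms(3,5) ws by simp
  then have "reduced_expression W S (subword_at Q (positions Q - I - {j})) v"
    using assms(4) j subword_at_lists[OF assms(2)] unfolding reduced_expression_def by metis
  moreover have "positions Q - I - {j} = positions Q - insert j I" by auto
  ultimately show ?thesis
    using I j by (intro bexI[of _ j]) (auto simp: facets_def)
qed

text \<open>Left exchange on any facet. With \<open>q \<otimes> \<rho>\<close> for \<open>w\<close>
  it shows that, if \<open>q\<close> is no descent of \<rho>, facets for
  \<open>q \<otimes> \<rho>\<close> would force facets for \<rho>.\<close>

lemma facets_descent_nonempty: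
  assumes "facets W S Q w \<noteq> {}" "set Q \<subseteq> S" "q \<in> S" "w \<in> carrier W" "len (q \<otimes> w) < len w"
  shows "facets W S Q (q \<otimes> w) \<noteq> {}"
proof -
  obtain I where I: "I \<in> facets W S Q w" using assms(1) by blast
  let ?ws = "subword_at Q (positions Q - I)"
  have ws: "?ws \<in> lists S" "word_prod W ?ws = w"
    using I by (simp_all add: facets_def reduced_expression_def)
  obtain i where "i < length ?ws" "word_prod W (take i ?ws @ drop (Suc i) ?ws) = q \<otimes> w"
    using exchange_left[OF ws(1) \<open>q \<in> S\<close>] assms(5) ws(2) by auto
  moreover have "len w = Suc (len (q \<otimes> w))"
    using len_gen_mult[OF assms(3,4)] assms(5) by auto
  ultimately show ?thesis using facet_insert_exists[OF I assms(2)] by blast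
qed

lemma facet_exchange_right:
  assumes "I \<in> facets W S Q w" "set Q \<subseteq> S" "s \<in> S" "w \<in> carrier W" "len (w \<otimes> s) < len w"
  shows "\<exists>j\<in>positions Q - I. insert j I \<in> facets W S Q (w \<otimes> s)"
proof -
  let ?ws = "subword_at Q (positions Q - I)"
  have ws: "?ws \<in> lists S" "word_prod W ?ws = w"
    using assms(1) by (simp_all add: facets_def reduced_expression_def)
  obtain i where "i < length ?ws" "word_prod W (take i ?ws @ drop (Suc i) ?ws) = w \<otimes> s"
    using exchange_right[OF ws(1) \<open>s \<in> S\<close>] assms(5) ws(2) by auto
  moreover have "len w = Suc (len (w \<otimes> s))"
    using len_mult_gen[OF assms(3,4)] assms(5) by auto
  ultimately show ?thesis using facet_insert_exists[OF assms(1,2)] by blast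
qed

text \<open>The source is computed by scanning the word from right to left and using every letter
  that shortens what remains of \<open>\<rho>\<close>.\<close>

lemma source_snoc:
  assumes "source W S (Q @ [s]) \<rho> I" "s \<in> S" "set Q \<subseteq> S" "\<rho> \<in> carrier W"
  defines "m \<equiv> int (length Q) + 1"
  shows "if len (\<rho> \<otimes> s) < len \<rho> then m \<notin> I \<and> source W S Q (\<rho> \<otimes> s) I
    else m \<in> I \<and> source W S Q \<rho> (I - {m})"
proof -
  note snoc = facets_snoc_iff[OF assms(2-4), folded m_def]
  have I: "I \<in> facets W S (Q @ [s]) \<rho>"
    and no: "\<And>J. J \<in> facets W S (Q @ [s]) \<rho> \<Longrightarrow> \<not> flips_up J I"
    using assms by (auto simp: source_def)
  have m: "x < m" if "x \<in> J" "J \<in> facets W S Q w" for x J w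
    using facet_subset[OF that(2)] that(1) by (auto simp: mem_positions m_def)
  show ?thesis
  proof (cases "len (\<rho> \<otimes> s) < len \<rho>")
    case True
    have "m \<notin> I"
    proof
      assume mI: "m \<in> I"
      with I snoc have "I - {m} \<in> facets W S Q \<rho>" by simp
      \<comment> \<open>Right exchange yields a facet with some j < m in place of m; flipping j to m
        then leads into the source \<open>I\<close>.\<close>
      then obtain j where j: "j \<in> positions Q - (I - {m})"
        "insert j (I - {m}) \<in> facets W S Q (\<rho> \<otimes> s)"
        using facet_exchange_right assms True by blast
      have "j < m" using j m by blast
      then have "insert j (I - {m}) \<in> facets W S (Q @ [s]) \<rho>"
        using j True by (subst snoc) auto
      moreover have "increasing_flip (insert j (I - {m})) I j m"
        using j \<open>j < m\<close> mI by (auto simp: increasing_flip_iff)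
      ultimately show False using no by (auto simp: flips_up_def)
    qed
    moreover have "J \<in> facets W S (Q @ [s]) \<rho>" if "J \<in> facets W S Q (\<rho> \<otimes> s)" for J
      using that True m[of m J] by (auto simp: snoc)
    ultimately show ?thesis using I True no by (auto simp: source_def snoc)
  next
    case False
    then have mI: "m \<in> I" and I': "I - {m} \<in> facets W S Q \<rho>"
      using I by (auto simp: snoc split: if_splits)
    \<comment> \<open>Adding m to both sets turns a predecessor of \<open>I - {m}\<close> into a
      predecessor of \<open>I\<close>.\<close>
    have "\<not> flips_up J (I - {m})" if "J \<in> facets W S Q \<rho>" for J
    proof
      assume "flips_up J (I - {m})"
      then obtain i j where ij: "i < j" "i \<in> J" "j \<notin> J" "I - {m} = insert j (J - {i})"
        by (auto simp: flips_up_def increasing_flip_iff)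
      have "m \<notin> J" using m[of m J] that by auto
      then have "insert m J \<in> facets W S (Q @ [s]) \<rho>" using that by (simp add: snoc)
      moreover have "increasing_flip (insert m J) I i j"
        using ij mI \<open>m \<notin> J\<close> unfolding increasing_flip_iff by blast
      ultimately show False using no by (auto simp: flips_up_def)
    qed
    then show ?thesis using False mI I' by (simp add: source_def)
  qed
qed

section \<open>Uniqueness and comparison of sources\<close>

text \<open>By \<open>source_snoc\<close> a descent alone decides whether the last position belongs
  to a source, and what remains is a source for a shorter word.\<close>

lemma source_unique:
  assumes "set Q \<subseteq> S" "\<rho> \<in> carrier W" "source W S Q \<rho> I" "source W S Q \<rho> J"
  shows "I = J"
  using assms
proof (induction Q arbitrary: \<rho> I J rule: rev_induct)
  case Nil
  then show ?case by (auto simp: source_def facets_def)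
next
  case (snoc s Q)
  let ?m = "int (length Q) + 1"
  have s: "s \<in> S" "set Q \<subseteq> S" "\<rho> \<otimes> s \<in> carrier W"
    using snoc.prems by (auto simp: gen_closed)
  note * = source_snoc[OF snoc.prems(3) s(1,2) snoc.prems(2)]
    source_snoc[OF snoc.prems(4) s(1,2) snoc.prems(2)]
  show ?case
  proof (cases "len (\<rho> \<otimes> s) < len \<rho>")
    case True
    then show ?thesis using * snoc.IH[OF s(2,3)] by simp
  next
    case False
    then have "I - {?m} = J - {?m}" "?m \<in> I" "?m \<in> J"
      using * snoc.IH[OF s(2) snoc.prems(2)] by auto
    then show ?thesis by blast
  qed
qed

lemma greedy_eq_source:
  assumes "set Q \<subseteq> S" "\<rho> \<in> carrier W" "source W S Q \<rho> I"
  shows "positive_greedy_facet W S Q \<rho> = I"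
proof -
  have "J \<in> pverts (flip_graph W S Q \<rho>) \<and> in_arcs (with_proj (flip_graph W S Q \<rho>)) J = {}
      \<longleftrightarrow> source W S Q \<rho> J" for J
    by (auto simp: flip_graph_def in_arcs_def source_def flips_up_def)
  moreover have "(THE J. source W S Q \<rho> J) = I"
    using assms source_unique by (intro the_equality) blast+
  ultimately show ?thesis
    by (simp add: positive_greedy_facet_def)
qed

text \<open>Compare the scans for \<rho> and \<open>q \<otimes> \<rho>\<close>. While they decide
  alike, \<open>q\<close> stays a left descent of what remains. At the first disagreement the letter
  is used only for \<rho>, and from then on the two scans coincide.\<close>

lemma source_descent:
  assumes "set Q \<subseteq> S" "\<rho> \<in> carrier W" "q \<in> S" "len (q \<otimes> \<rho>) < len \<rho>"
    and "source W S Q \<rho> X" "source W S Q (q \<otimes> \<rho>) Y"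
  shows "\<exists>j. j \<notin> X \<and> Y = insert j X"
  using assms
proof (induction Q arbitrary: \<rho> X Y rule: rev_induct)
  case Nil
  then show ?case by (auto simp: source_def facets_def reduced_expression_def)
next
  case (snoc s Q)
  let ?m = "int (length Q) + 1" and ?u = "q \<otimes> \<rho>"
  have s: "s \<in> S" "set Q \<subseteq> S" "s \<in> carrier W" "\<rho> \<otimes> s \<in> carrier W" "q \<in> carrier W" "?u \<in> carrier W"
    using snoc.prems by (auto simp: gen_closed)
  have assoc: "?u \<otimes> s = q \<otimes> (\<rho> \<otimes> s)" using s snoc.prems by (simp add: m_assoc)
  note X = source_snoc[OF snoc.prems(5) s(1,2) snoc.prems(2)]
    and Y = source_snoc[OF snoc.prems(6) s(1,2) s(6)]
  note lens = len_gen_mult[OF \<open>q \<in> S\<close> \<open>\<rho> \<in> carrier W\<close>] len_mult_gen[OF \<open>s \<in> S\<close> \<open>\<rho> \<in> carrier W\<close>]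
    len_gen_mult[OF \<open>q \<in> S\<close> \<open>\<rho> \<otimes> s \<in> carrier W\<close>, folded assoc] len_mult_gen[OF \<open>s \<in> S\<close> \<open>?u \<in> carrier W\<close>]
  show ?case
  proof (cases "len (\<rho> \<otimes> s) < len \<rho>")
    case True
    show ?thesis
    proof (cases "len (?u \<otimes> s) < len ?u")
      case uT: True
      \<comment> \<open>Both lengths drop by one, so the descent by \<open>q\<close> persists and
        the induction applies.\<close>
      then have "len (q \<otimes> (\<rho> \<otimes> s)) < len (\<rho> \<otimes> s)"
        using lens True snoc.prems(4) unfolding assoc by linarith
      then show ?thesis
        using snoc.IH[OF s(2) s(4) \<open>q \<in> S\<close>] X Y True uT assoc by auto
    next
      case False
      \<comment> \<open>The disagreement: using \<open>s\<close> for \<rho> has the same effect as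
        \<open>q\<close> had, so both scans continue with the same element and \<open>?m\<close> is
        the extra position.\<close>
      then have "\<rho> \<otimes> s = ?u"
        using two_sided_descent snoc.prems s True by blast
      then have "X = Y - {?m}" "?m \<in> Y" "?m \<notin> X"
        using X Y True False source_unique[OF s(2) s(6)] by auto
      then show ?thesis by blast
    qed
  next
    case False
    \<comment> \<open>The opposite disagreement would make the lengths of
      \<open>\<rho> \<otimes> s\<close> and \<open>q \<otimes> (\<rho> \<otimes> s)\<close> differ
      by three.\<close>
    then have "\<not> len (?u \<otimes> s) < len ?u"
      using lens snoc.prems(4) by linarith
    then have "?m \<in> X" "?m \<in> Y" "source W S Q \<rho> (X - {?m})" "source W S Q ?u (Y - {?m})"
      using X Y False by auto
    moreover from this obtain j where "j \<notin> X - {?m}" "Y - {?m} = insert j (X - {?m})"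
      using snoc.IH[OF s(2) snoc.prems(2-4)] by blast
    ultimately show ?thesis by blast
  qed
qed

text \<open>Deleting two different letters of a reduced word never gives the same shorter element.
  Induction on the last letter reduces this to the case where just one of the two deletions is at
  the end.\<close>

lemma facet_insert_unique:
  assumes "set Q \<subseteq> S" "\<rho> \<in> carrier W" "\<sigma> \<in> carrier W" "len \<sigma> < len \<rho>"
    and "X \<in> facets W S Q \<rho>" "insert i X \<in> facets W S Q \<sigma>" "insert j X \<in> facets W S Q \<sigma>"
    and "i \<notin> X" "j \<notin> X"
  shows "i = j"
  using assms
proof (induction Q arbitrary: \<rho> \<sigma> X rule: rev_induct)
  case Nil
  then show ?case by (auto simp: facets_def)
next
  case (snoc s Q)
  define m where "m = int (length Q) + 1"
  have s: "s \<in> S" "set Q \<subseteq> S" "s \<in> carrier W" "\<rho> \<otimes> s \<in> carrier W" "\<sigma> \<otimes> s \<in> carrier W"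
    using snoc.prems by (auto simp: gen_closed)
  note snoc_\<rho> = facets_snoc_iff[OF s(1,2) \<open>\<rho> \<in> carrier W\<close>, folded m_def]
    and snoc_\<sigma> = facets_snoc_iff[OF s(1,2) \<open>\<sigma> \<in> carrier W\<close>, folded m_def]
  \<comment> \<open>Deleting the last letter gives \<open>\<rho> \<otimes> s = \<sigma>\<close>. The
    other word still ends in \<open>s\<close>, so \<open>\<sigma> \<otimes> s\<close>, which is
    \<rho>, would be shorter than \<sigma>.\<close>
  have last: False
    if "insert m X \<in> facets W S (Q @ [s]) \<sigma>" "insert k X \<in> facets W S (Q @ [s]) \<sigma>"
      "k \<noteq> m" "m \<notin> X" for k
  proof -
    have "X \<in> facets W S Q (\<rho> \<otimes> s)" "X \<in> facets W S Q \<sigma>" "len (\<sigma> \<otimes> s) < len \<sigma>"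
      using that snoc.prems(5) by (auto simp: snoc_\<rho> snoc_\<sigma>)
    moreover from this have "\<rho> \<otimes> s = \<sigma>" by (auto simp: facets_def reduced_expression_def)
    then have "\<sigma> \<otimes> s = \<rho>" using s snoc.prems by auto
    ultimately show False using snoc.prems(4) by simp
  qed
  show ?case
  proof (cases "m \<in> X")
    case True
    then have "i \<noteq> m" "j \<noteq> m" using snoc.prems by auto
    then have "insert i (X - {m}) \<in> facets W S Q \<sigma>" "insert j (X - {m}) \<in> facets W S Q \<sigma>"
      "X - {m} \<in> facets W S Q \<rho>"
      using snoc.prems True by (auto simp: snoc_\<rho> snoc_\<sigma> insert_Diff_if)
    then show ?thesis using snoc.IH[OF s(2) snoc.prems(2-4)] snoc.prems(8,9) by blast
  next
    case False
    show ?thesis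
    proof (cases "i = m \<or> j = m")
      case True
      then show ?thesis using last False snoc.prems by metis
    next
      case neither: False
      then have *: "insert i X \<in> facets W S Q (\<sigma> \<otimes> s)" "insert j X \<in> facets W S Q (\<sigma> \<otimes> s)"
        "X \<in> facets W S Q (\<rho> \<otimes> s)" "len (\<sigma> \<otimes> s) < len \<sigma>"
        using snoc.prems False by (auto simp: snoc_\<rho> snoc_\<sigma>)
      then have "len (\<sigma> \<otimes> s) < len (\<rho> \<otimes> s)"
        using len_mult_gen[OF s(1) snoc.prems(2)] len_mult_gen[OF s(1) snoc.prems(3)] snoc.prems(4)
        by linarith
      with * show ?thesis using snoc.IH[OF s(2,4,5)] snoc.prems(8,9) by blast
    qed
  qed
qed

end

section \<open>Rising paths\<close>

definition flip_arcs :: "int set set \<Rightarrow> (int set \<times> int set) set" where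
  "flip_arcs F = {(X, Y). X \<in> F \<and> Y \<in> F \<and> flips_up X Y}"

text \<open>The family \<open>F\<close> is arbitrary, so that this also applies to the facets with
  1, to those without 1, and to shifted copies. Walks replace paths.\<close>

definition rising_arcs :: "int set set \<Rightarrow> int set \<Rightarrow> (int set \<times> int set) set" where
  "rising_arcs F X =
    \<Union>{set es | es Y. set es \<subseteq> flip_arcs F \<and> pcas X es Y \<and> p_rising es}"

lemma rising_arcsI:
  "e \<in> set es \<Longrightarrow> set es \<subseteq> flip_arcs F \<Longrightarrow> pcas X es Y \<Longrightarrow> p_rising es \<Longrightarrow> e \<in> rising_arcs F X"
  unfolding rising_arcs_def by blast

lemma rising_arcsE:
  assumes "e \<in> rising_arcs F X"
  obtains es Y where "e \<in> set es" "set es \<subseteq> flip_arcs F" "pcas X es Y" "p_rising es"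
  using assms unfolding rising_arcs_def by blast

lemma rising_arcs_empty [simp]: "rising_arcs {} X = {}"
  by (auto simp: flip_arcs_def elim: rising_arcsE)

text \<open>Sums grow strictly along a walk, so every walk is a path.\<close>

lemma flip_walk_distinct:
  assumes "set es \<subseteq> flip_arcs F" "pcas X es Y" "\<And>Z. Z \<in> F \<Longrightarrow> finite Z"
  shows "(\<forall>Z\<in>set (pawalk_verts X es). \<Sum>X \<le> \<Sum>Z) \<and> distinct (pawalk_verts X es)"
  using assms(1,2)
proof (induction es arbitrary: X)
  case (Cons e es)
  obtain Z where e: "e = (X, Z)" using Cons.prems by (cases e) auto
  then have "\<Sum>X < \<Sum>Z"
    using Cons.prems assms(3) by (auto simp: flip_arcs_def intro!: sum_less_if_flips_up)
  moreover have "(\<forall>V\<in>set (pawalk_verts Z es). \<Sum>Z \<le> \<Sum>V) \<and> distinct (pawalk_verts Z es)"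
    using Cons.prems e by (intro Cons.IH) auto
  ultimately show ?case using e by fastforce
qed simp

lemma positive_source_tree_eq:
  "positive_source_tree G S Q \<rho> =
    \<lparr>pverts = facets G S Q \<rho>, parcs = rising_arcs (facets G S Q \<rho>) (positive_greedy_facet G S Q \<rho>)\<rparr>"
proof -
  let ?F = "facets G S Q \<rho>" and ?P = "positive_greedy_facet G S Q \<rho>"
  have "pre_digraph.apath (with_proj (flip_graph G S Q \<rho>)) X es Y \<longleftrightarrow>
      X \<in> ?F \<and> set es \<subseteq> flip_arcs ?F \<and> pcas X es Y" for X es Y
    using flip_walk_distinct[of es ?F X Y] finite_facet[of _ G S Q \<rho>]
    by (auto simp: pre_digraph.apath_def pre_digraph.awalk_def cas_with_proj_eq
        awalk_verts_with_proj_eq flip_graph_def flip_arcs_def flips_up_def)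
  \<comment> \<open>Paths must start in a facet, walks in \<open>rising_arcs\<close> need not; the
    only such walk is empty and contributes no arc.\<close>
  moreover have "X \<in> ?F \<or> es = []" if "set es \<subseteq> flip_arcs ?F" "pcas X es Y" for X es Y
    using that by (cases es) (auto simp: flip_arcs_def)
  ultimately have "\<Union>{set es | es J.
      pre_digraph.apath (with_proj (flip_graph G S Q \<rho>)) ?P es J \<and> p_rising es} = rising_arcs ?F ?P"
    unfolding rising_arcs_def by fastforce
  then show ?thesis by (simp add: positive_source_tree_def)
qed

lemma pcas_map_prodD:
  assumes "inj_on f F" "X \<in> F" "set es \<subseteq> F \<times> F" "pcas (f X) (map (map_prod f f) es) Y"
  shows "\<exists>Y. pcas X es Y"
  using assms(2-)
proof (induction es arbitrary: X)
  case (Nil X)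
  have "pcas X [] X" by simp
  then show ?case by blast
next
  case (Cons e es)
  then show ?case using inj_onD[OF assms(1)] by (cases e) auto
qed

lemma pcas_map_prod:
  "pcas X es Y \<Longrightarrow> pcas (f X) (map (map_prod f f) es) (f Y)"
  by (induction es arbitrary: X) auto

text \<open>The map moves all labels up by one, which keeps their order; injectivity lets walks be
  pulled back. It is used for \<open>shift\<close> and \<open>shift_cone\<close>.\<close>

lemma rising_arcs_image:
  assumes inj: "inj_on f F" and X: "X \<in> F"
    and flip: "\<And>X Y i j. X \<in> F \<Longrightarrow> Y \<in> F \<Longrightarrow>
      increasing_flip (f X) (f Y) i j \<longleftrightarrow> increasing_flip X Y (i - 1) (j - 1)"
  shows "rising_arcs (f ` F) (f X) = map_prod f f ` rising_arcs F X"
proof -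
  have up: "flips_up (f X) (f Y) \<longleftrightarrow> flips_up X Y" if "X \<in> F" "Y \<in> F" for X Y
    unfolding flips_up_def using flip[OF that] by (metis add_diff_cancel_right')
  have arcs: "flip_arcs (f ` F) = map_prod f f ` flip_arcs F"
    using up by (force simp: flip_arcs_def)
  have label: "p_label (map_prod f f e) = p_label e + 1" if e: "e \<in> flip_arcs F" for e
  proof -
    obtain X Y i j where e: "e = (X, Y)" "X \<in> F" "Y \<in> F" "increasing_flip X Y i j"
      using e unfolding flip_arcs_def flips_up_def by blast
    then have "increasing_flip (f X) (f Y) (i + 1) (j + 1)" by (simp add: flip)
    then show ?thesis using e by (simp add: p_label_eq)
  qed
  have rising: "p_rising (map (map_prod f f) es) \<longleftrightarrow> p_rising es" if "set es \<subseteq> flip_arcs F" for es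
    using that
  proof (induction es)
    case (Cons e es)
    then have "p_label (map_prod f f a) = p_label a + 1" if "a \<in> set (e # es)" for a
      using that Cons.prems by (intro label) auto
    then show ?case using Cons by (auto simp: p_rising_def)
  qed (simp add: p_rising_def)
  show ?thesis
  proof (intro equalityI subsetI)
    fix e assume "e \<in> rising_arcs (f ` F) (f X)"
    then obtain es Y where es: "e \<in> set es" "set es \<subseteq> map_prod f f ` flip_arcs F"
      "pcas (f X) es Y" "p_rising es"
      by (auto simp: arcs elim: rising_arcsE)
    then have "es \<in> lists (map_prod f f ` flip_arcs F)" by (simp add: lists_eq_set)
    then obtain ds where "ds \<in> lists (flip_arcs F)" "es = map (map_prod f f) ds"
      unfolding lists_image by (rule imageE)
    then have ds: "es = map (map_prod f f) ds" "set ds \<subseteq> flip_arcs F" by (auto simp: lists_eq_set)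
    have "set ds \<subseteq> F \<times> F" using ds by (auto simp: flip_arcs_def)
    then obtain Z where "pcas X ds Z"
      using pcas_map_prodD[OF inj X, of ds Y] es(3) ds(1) by blast
    then have "set ds \<subseteq> rising_arcs F X"
      using ds es rising by (auto intro: rising_arcsI)
    then show "e \<in> map_prod f f ` rising_arcs F X" using ds es(1) by auto
  next
    fix e assume "e \<in> map_prod f f ` rising_arcs F X"
    then obtain d where d: "d \<in> rising_arcs F X" "e = map_prod f f d" by auto
    then obtain es Y where es: "d \<in> set es" "set es \<subseteq> flip_arcs F" "pcas X es Y" "p_rising es"
      by (auto elim: rising_arcsE)
    show "e \<in> rising_arcs (f ` F) (f X)"
    proof (rule rising_arcsI)
      show "e \<in> set (map (map_prod f f) es)" using d es by auto
      show "set (map (map_prod f f) es) \<subseteq> flip_arcs (f ` F)" using es by (auto simp: arcs)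
      show "pcas (f X) (map (map_prod f f) es) (f Y)" using es by (intro pcas_map_prod)
      show "p_rising (map (map_prod f f) es)" using es rising by blast
    qed
  qed
qed

section \<open>Walks and the position 1\<close>

text \<open>An increasing flip inserts a position larger than the one removed, hence larger than
  1.\<close>

lemma flip_walk_avoiding_1:
  assumes "set es \<subseteq> flip_arcs F" "pcas X es Y" "1 \<notin> X" "\<And>Z x. Z \<in> F \<Longrightarrow> x \<in> Z \<Longrightarrow> 1 \<le> x"
  shows "set es \<subseteq> flip_arcs {Z \<in> F. 1 \<notin> Z}"
  using assms(1-3)
proof (induction es arbitrary: X)
  case (Cons e es)
  obtain Z where e: "e = (X, Z)" using Cons.prems by (cases e) auto
  have F: "X \<in> F" "Z \<in> F" "flips_up X Z" using Cons.prems e by (auto simp: flip_arcs_def)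
  then have "1 \<notin> Z"
    using Cons.prems(3) assms(4)[OF \<open>X \<in> F\<close>] by (force simp: flips_up_def increasing_flip_iff)
  then have "set es \<subseteq> flip_arcs {Z \<in> F. 1 \<notin> Z}" using Cons e by auto
  then show ?case using e F \<open>1 \<notin> Z\<close> Cons.prems(3) by (auto simp: flip_arcs_def)
qed simp

text \<open>A flip removes only its label, so 1 stays as long as no label is 1.\<close>

lemma flip_walk_through_1:
  assumes "set es \<subseteq> flip_arcs F" "pcas X es Y" "1 \<in> X" "\<And>e. e \<in> set es \<Longrightarrow> p_label e \<noteq> 1"
  shows "set es \<subseteq> flip_arcs {Z \<in> F. 1 \<in> Z}"
  using assms
proof (induction es arbitrary: X)
  case (Cons e es)
  obtain Z where e: "e = (X, Z)" using Cons.prems by (cases e) auto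
  have F: "X \<in> F" "Z \<in> F" "flips_up X Z" using Cons.prems e by (auto simp: flip_arcs_def)
  then obtain i j where ij: "increasing_flip X Z i j" by (auto simp: flips_up_def)
  then have "i \<noteq> 1" using Cons.prems(4)[of e] e p_label_eq by auto
  then have "1 \<in> Z" using ij Cons.prems(3) by (auto simp: increasing_flip_iff)
  then have "set es \<subseteq> flip_arcs {Z \<in> F. 1 \<in> Z}" using Cons e by auto
  then show ?case using e F \<open>1 \<in> Z\<close> Cons.prems(3) by (auto simp: flip_arcs_def)
qed simp

lemma p_label_ge_1:
  assumes "e \<in> flip_arcs F" "\<And>Z x. Z \<in> F \<Longrightarrow> x \<in> Z \<Longrightarrow> 1 \<le> x"
  shows "1 \<le> p_label e" and "1 \<notin> fst e \<Longrightarrow> 1 < p_label e"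
proof -
  obtain X Y i j where e: "e = (X, Y)" "X \<in> F" "increasing_flip X Y i j"
    using assms by (auto simp: flip_arcs_def flips_up_def)
  then have "p_label e = i" "i \<in> X" by (auto simp: p_label_eq increasing_flip_iff)
  then show "1 \<le> p_label e" and "1 \<notin> fst e \<Longrightarrow> 1 < p_label e"
    using assms(2)[OF e(2)] e(1) by (auto simp: order_less_le)
qed

text \<open>Since labels increase along a rising path, the position 1 can only be flipped out by
  the first edge.\<close>

lemma rising_arcs_split:
  assumes ge_1: "\<And>Z x. Z \<in> F \<Longrightarrow> x \<in> Z \<Longrightarrow> 1 \<le> x"
    and P: "P \<in> F" "1 \<in> P" and R: "R \<in> F" "1 \<notin> R" "flips_up P R"
    and unique: "\<And>Z. Z \<in> F \<Longrightarrow> 1 \<notin> Z \<Longrightarrow> flips_up P Z \<Longrightarrow> Z = R"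
  shows "rising_arcs F P =
    rising_arcs {Z \<in> F. 1 \<notin> Z} R \<union> rising_arcs {Z \<in> F. 1 \<in> Z} P \<union> {(P, R)}"
proof (intro equalityI subsetI)
  fix e assume "e \<in> rising_arcs F P"
  then obtain es Y where es: "e \<in> set es" "set es \<subseteq> flip_arcs F" "pcas P es Y" "p_rising es"
    by (auto elim: rising_arcsE)
  then obtain Z ds where ds: "es = (P, Z) # ds" by (cases es) (auto intro: prod_eqI)
  have Z: "Z \<in> F" "flips_up P Z" using es ds by (auto simp: flip_arcs_def)
  show "e \<in> rising_arcs {Z \<in> F. 1 \<notin> Z} R \<union> rising_arcs {Z \<in> F. 1 \<in> Z} P \<union> {(P, R)}"
  proof (cases "1 \<in> Z")
    case False
    then have "Z = R" using unique Z by blast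
    have "set ds \<subseteq> flip_arcs {Z \<in> F. 1 \<notin> Z}"
      using flip_walk_avoiding_1[of ds F Z Y] ge_1 False es ds by auto
    then have "set ds \<subseteq> rising_arcs {Z \<in> F. 1 \<notin> Z} R"
      using es ds \<open>Z = R\<close> by (auto simp: p_rising_def intro: rising_arcsI)
    then show ?thesis using es ds \<open>Z = R\<close> by auto
  next
    case True
    obtain i j where ij: "increasing_flip P Z i j" using Z by (auto simp: flips_up_def)
    \<comment> \<open>As 1 survives the first flip, the first label exceeds 1, and so do all later
      labels.\<close>
    then have "i \<noteq> 1" using True by (auto simp: increasing_flip_iff)
    then have "1 < p_label (P, Z)"
      using p_label_eq[OF ij] p_label_ge_1(1)[of "(P, Z)" F] ge_1 es ds by auto
    then have "p_label a \<noteq> 1" if "a \<in> set es" for a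
      using that es ds by (auto simp: p_rising_def)
    then have "set es \<subseteq> flip_arcs {Z \<in> F. 1 \<in> Z}"
      using flip_walk_through_1[of es F P Y] P es by blast
    then show ?thesis using es by (auto intro: rising_arcsI)
  qed
next
  fix e assume e: "e \<in> rising_arcs {Z \<in> F. 1 \<notin> Z} R \<union> rising_arcs {Z \<in> F. 1 \<in> Z} P \<union> {(P, R)}"
  have PR: "(P, R) \<in> flip_arcs F" using P R by (simp add: flip_arcs_def)
  have sub: "flip_arcs {Z \<in> F. Q Z} \<subseteq> flip_arcs F" for Q by (auto simp: flip_arcs_def)
  obtain i j where ij: "increasing_flip P R i j" using R by (auto simp: flips_up_def)
  then have "i = 1" using P R by (auto simp: increasing_flip_iff)
  then have label: "p_label (P, R) = 1" using p_label_eq[OF ij] by simp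
  have via: "a \<in> rising_arcs F P"
    if "a \<in> set ((P, R) # es)" "set es \<subseteq> flip_arcs {Z \<in> F. 1 \<notin> Z}" "pcas R es Y" "p_rising es"
    for a es Y
  proof (rule rising_arcsI)
    show "a \<in> set ((P, R) # es)" by fact
    show "set ((P, R) # es) \<subseteq> flip_arcs F"
      using PR order_trans[OF that(2) sub] by simp
    show "pcas P ((P, R) # es) Y" using that by simp
    \<comment> \<open>After the jump 1 has gone and cannot be a label, so a rising walk from
      \<open>R\<close> stays rising when the arc with label 1 is put in front.\<close>
    have "1 < p_label b" if "b \<in> set es" for b
      using p_label_ge_1(2)[of b F] that ge_1 \<open>set es \<subseteq> _\<close> by (auto simp: flip_arcs_def)
    then show "p_rising ((P, R) # es)" using that label by (auto simp: p_rising_def)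
  qed
  from e consider "e \<in> rising_arcs {Z \<in> F. 1 \<notin> Z} R" | "e \<in> rising_arcs {Z \<in> F. 1 \<in> Z} P" | "e = (P, R)"
    by blast
  then show "e \<in> rising_arcs F P"
  proof cases
    case 1
    then obtain es Y where "e \<in> set es" "set es \<subseteq> flip_arcs {Z \<in> F. 1 \<notin> Z}"
      "pcas R es Y" "p_rising es"
      by (rule rising_arcsE)
    then show ?thesis using via[of e es Y] by simp
  next
    case 2
    then show ?thesis using sub by (elim rising_arcsE) (blast intro: rising_arcsI)
  next
    case 3
    then show ?thesis using via[of e "[]"] by (auto simp: p_rising_def)
  qed
qed

section \<open>Source trees of a word and of its tail\<close>

context coxeter
begin

lemma zero_notin_facet: "I \<in> facets W S Q \<rho> \<Longrightarrow> 0 \<notin> I"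
  using facet_ge_1[of I W S Q \<rho> 0] by auto

lemma shift_tree_source_tree:
  assumes "set Q \<subseteq> S" "\<rho> \<in> carrier W" "source W S Q \<rho> X"
  shows "shift_tree (positive_source_tree W S Q \<rho>) =
    \<lparr>pverts = shift ` facets W S Q \<rho>, parcs = rising_arcs (shift ` facets W S Q \<rho>) (shift X)\<rparr>"
proof -
  have "rising_arcs (shift ` facets W S Q \<rho>) (shift X) =
      map_prod shift shift ` rising_arcs (facets W S Q \<rho>) X"
    using assms by (intro rising_arcs_image increasing_flip_shift)
      (auto simp: source_def intro: inj_on_subset[OF inj_shift])
  moreover have "shift_tree T =
      \<lparr>pverts = shift ` pverts T, parcs = map_prod shift shift ` parcs T\<rparr>" for T
    unfolding shift_tree_def by (auto simp: map_prod_def image_iff Bex_def)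
  ultimately show ?thesis
    by (simp only: positive_source_tree_eq greedy_eq_source[OF assms] pair_pre_digraph.simps)
qed

lemma join_shift_tree_source_tree:
  assumes "set Q \<subseteq> S" "\<rho> \<in> carrier W" "source W S Q \<rho> X"
  shows "1 \<star> shift_tree (positive_source_tree W S Q \<rho>) =
    \<lparr>pverts = shift_cone ` facets W S Q \<rho>,
     parcs = rising_arcs (shift_cone ` facets W S Q \<rho>) (shift_cone X)\<rparr>"
proof -
  have "rising_arcs (shift_cone ` facets W S Q \<rho>) (shift_cone X) =
      map_prod shift_cone shift_cone ` rising_arcs (facets W S Q \<rho>) X"
  proof (rule rising_arcs_image[where f = shift_cone])
    show "inj_on shift_cone (facets W S Q \<rho>)"
    proof (rule inj_onI)
      fix X Y assume "X \<in> facets W S Q \<rho>" "Y \<in> facets W S Q \<rho>" "shift_cone X = shift_cone Y"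
      then show "X = Y" using shift_cone_eq_iff[of X Y] zero_notin_facet by blast
    qed
    show "X \<in> facets W S Q \<rho>" using assms by (simp add: source_def)
    show "increasing_flip (shift_cone X) (shift_cone Y) i j \<longleftrightarrow> increasing_flip X Y (i - 1) (j - 1)"
      if "X \<in> facets W S Q \<rho>" "Y \<in> facets W S Q \<rho>" for X Y i j
      using that zero_notin_facet increasing_flip_shift_cone by blast
  qed
  moreover have "1 \<star> shift_tree T =
      \<lparr>pverts = shift_cone ` pverts T, parcs = map_prod shift_cone shift_cone ` parcs T\<rparr>" for T
    unfolding join_tree_def shift_tree_def by (auto simp: map_prod_def image_iff Bex_def)
  ultimately show ?thesis
    by (simp only: positive_source_tree_eq greedy_eq_source[OF assms] pair_pre_digraph.simps)
qed

text \<open>No increasing flip inserts 1, so a predecessor of a cone is again a cone and comes from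
  a predecessor of \<open>X\<close>. In the second claim all facets are shifts.\<close>

lemma source_ConsI:
  assumes "q \<in> S" "set Q \<subseteq> S" "\<rho> \<in> carrier W"
  shows "source W S Q \<rho> X \<Longrightarrow> source W S (q # Q) \<rho> (shift_cone X)"
    and "source W S Q (q \<otimes> \<rho>) Y \<Longrightarrow> facets W S Q \<rho> = {} \<Longrightarrow> len (q \<otimes> \<rho>) < len \<rho> \<Longrightarrow>
      source W S (q # Q) \<rho> (shift Y)"
proof -
  note F = facets_Cons[OF assms]
  assume X: "source W S Q \<rho> X"
  have "\<not> flips_up J (shift_cone X)" if J: "J \<in> facets W S (q # Q) \<rho>" for J
  proof
    assume up: "flips_up J (shift_cone X)"
    then obtain i j where ij: "i < j" "i \<in> J" "j \<notin> J" "shift_cone X = insert j (J - {i})"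
      by (auto simp: flips_up_def increasing_flip_iff)
    have "1 \<le> i" using facet_ge_1[OF J ij(2)] .
    have "1 \<in> insert j (J - {i})" unfolding ij(4)[symmetric] by simp
    then have "1 \<in> J" using \<open>1 \<le> i\<close> ij(1) by auto
    then obtain Z where Z: "Z \<in> facets W S Q \<rho>" "J = shift_cone Z" using F(1) J by blast
    then have "flips_up Z X"
      using up X increasing_flip_shift_cone[of Z X] zero_notin_facet
      by (auto simp: flips_up_def source_def)
    then show False using X Z by (auto simp: source_def)
  qed
  then show "source W S (q # Q) \<rho> (shift_cone X)"
    using X F(1) by (auto simp: source_def)
next
  note F = facets_Cons[OF assms]
  assume Y: "source W S Q (q \<otimes> \<rho>) Y" "facets W S Q \<rho> = {}" "len (q \<otimes> \<rho>) < len \<rho>"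
  then have "facets W S (q # Q) \<rho> = shift ` facets W S Q (q \<otimes> \<rho>)" using F by auto
  then show "source W S (q # Q) \<rho> (shift Y)"
    using Y by (auto simp: source_def flips_up_def increasing_flip_shift)
qed

text \<open>A flip from the cone to a set without 1 removes 1, so \<open>Z\<close> is
  \<open>X\<close> with one added position. By \<open>source_descent\<close> the source
  \<open>Y\<close> has this form, and by \<open>facet_insert_unique\<close> nothing else
  does.\<close>

lemma source_flip_first:
  assumes "q \<in> S" "set Q \<subseteq> S" "\<rho> \<in> carrier W" "len (q \<otimes> \<rho>) < len \<rho>"
    and "source W S Q \<rho> X" "source W S Q (q \<otimes> \<rho>) Y"
    and "Z \<in> facets W S Q (q \<otimes> \<rho>)"
  shows "flips_up (shift_cone X) (shift Z) \<longleftrightarrow> Z = Y"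
proof -
  have X: "X \<in> facets W S Q \<rho>" and Y: "Y \<in> facets W S Q (q \<otimes> \<rho>)"
    using assms by (auto simp: source_def)
  have up: "flips_up (shift_cone X) (shift Z) \<longleftrightarrow> (\<exists>j. j \<notin> X \<and> Z = insert j X)"
    if "Z \<in> facets W S Q (q \<otimes> \<rho>)" for Z
  proof -
    have 0: "0 \<notin> X" "0 \<notin> Z" using X that zero_notin_facet by blast+
    show ?thesis
    proof
      assume "flips_up (shift_cone X) (shift Z)"
      then obtain i j where ij: "i < j" "j \<notin> shift_cone X" "shift Z = insert j (shift_cone X - {i})"
        by (auto simp: flips_up_def increasing_flip_iff)
      have "1 \<notin> insert j (shift_cone X - {i})" unfolding ij(3)[symmetric] using 0 by simp
      then have "i = 1" by simp
      have "insert j (shift_cone X - {1}) = shift (insert (j - 1) X)" using 0 by auto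
      then have "shift Z = shift (insert (j - 1) X)" using ij(3) \<open>i = 1\<close> by simp
      then have "Z = insert (j - 1) X" by (rule injD[OF inj_shift])
      then show "\<exists>j. j \<notin> X \<and> Z = insert j X" using ij by auto
    next
      assume "\<exists>j. j \<notin> X \<and> Z = insert j X"
      then obtain j where j: "j \<notin> X" "Z = insert j X" by blast
      \<comment> \<open>After the shift the inserted position is at least 2, so flipping out 1 is
        increasing.\<close>
      then have "1 \<le> j" using facet_subset[OF that] by (auto simp: mem_positions)
      then have "increasing_flip (shift_cone X) (shift Z) 1 (j + 1)"
        using j 0 by (auto simp: increasing_flip_iff)
      then show "flips_up (shift_cone X) (shift Z)" by (auto simp: flips_up_def)
    qed
  qed
  obtain j where j: "j \<notin> X" "Y = insert j X"
    using source_descent[OF assms(2,3,1,4-6)] by blast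
  have "k = j" if "k \<notin> X" "Z = insert k X" for k
    using facet_insert_unique[OF assms(2,3) _ assms(4) X] that j Y assms gen_closed by blast
  then show ?thesis using up[OF assms(7)] j by blast
qed

text \<open>Facets without 1 give the copy \<open>A\<close>, facets with 1 the copy
  \<open>B\<close>. If both occur, the greedy facet contains 1, and its only flip to a facet without
  1 ends at \<open>R\<close>.\<close>

lemma source_tree_Cons:
  assumes q: "q \<in> S" and Q: "set Q \<subseteq> S" and \<rho>: "\<rho> \<in> carrier W"
  defines "F \<equiv> facets W S (q # Q) \<rho>"
    and "T \<equiv> positive_source_tree W S (q # Q) \<rho>"
    and "A \<equiv> shift_tree (positive_source_tree W S Q (q \<otimes> \<rho>))"
    and "B \<equiv> 1 \<star> shift_tree (positive_source_tree W S Q \<rho>)"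
    and "P \<equiv> positive_greedy_facet W S (q # Q) \<rho>"
    and "R \<equiv> shift (positive_greedy_facet W S Q (q \<otimes> \<rho>))"
  shows "\<forall>I\<in>F. 1 \<notin> I \<Longrightarrow> T = A"
    and "\<forall>I\<in>F. 1 \<in> I \<Longrightarrow> T = B"
    and "\<not> (\<forall>I\<in>F. 1 \<notin> I) \<Longrightarrow> \<not> (\<forall>I\<in>F. 1 \<in> I) \<Longrightarrow>
      pverts A \<inter> pverts B = {} \<and>
      P = {1} \<union> shift (positive_greedy_facet W S Q \<rho>) \<and>
      T = \<lparr>pverts = pverts A \<union> pverts B, parcs = parcs A \<union> parcs B \<union> {(P, R)}\<rparr>"
proof -
  let ?F0 = "facets W S Q \<rho>" and ?F1 = "facets W S Q (q \<otimes> \<rho>)"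
  have q\<rho>: "q \<otimes> \<rho> \<in> carrier W" and qQ: "set (q # Q) \<subseteq> S" using q Q \<rho> by (auto simp: gen_closed)
  note cone = facets_Cons(1)[OF q Q \<rho>, folded F_def]
    and base = facets_Cons(2)[OF q Q \<rho>, folded F_def]
  have split: "F = {I \<in> F. 1 \<in> I} \<union> {I \<in> F. 1 \<notin> I}" by blast
  have T: "T = \<lparr>pverts = F, parcs = rising_arcs F P\<rparr>"
    by (simp add: T_def F_def P_def positive_source_tree_eq)
  have empty: "shift_tree (positive_source_tree W S Q w) = \<lparr>pverts = {}, parcs = {}\<rparr>"
    if "facets W S Q w = {}" for w
    using that by (simp add: positive_source_tree_eq shift_tree_def)
  show "T = A" if none: "\<forall>I\<in>F. 1 \<notin> I"
  proof -
    have F0: "?F0 = {}" using none cone by auto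
    \<comment> \<open>Facets of the tail for \<open>q \<otimes> \<rho>\<close> could be invisible in
      \<open>F\<close> only if \<open>q\<close> were no descent; exchange would then produce a facet
      for \<rho>, hence one with 1.\<close>
    have less: "len (q \<otimes> \<rho>) < len \<rho>" if "?F1 \<noteq> {}"
    proof (rule ccontr)
      assume "\<not> len (q \<otimes> \<rho>) < len \<rho>"
      then have "len (q \<otimes> (q \<otimes> \<rho>)) < len (q \<otimes> \<rho>)"
        using len_gen_mult[OF q \<rho>] q \<rho> by simp
      then show False using facets_descent_nonempty[OF that Q q q\<rho>] F0 q \<rho> by simp
    qed
    then have F: "F = shift ` ?F1" using split cone base F0 by auto
    show ?thesis
    proof (cases "?F1 = {}")
      case True
      then show ?thesis using F by (simp add: T A_def empty)
    next
      case False
      obtain Y where Y: "source W S Q (q \<otimes> \<rho>) Y" using source_exists[OF False] by blast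
      then have "P = shift Y"
        unfolding P_def using source_ConsI(2)[OF q Q \<rho> Y F0] less False
        by (intro greedy_eq_source[OF qQ \<rho>]) blast
      then show ?thesis using F shift_tree_source_tree[OF Q q\<rho> Y] by (simp add: T A_def)
    qed
  qed
  show "T = B" if "\<forall>I\<in>F. 1 \<in> I"
  proof -
    have F: "F = shift_cone ` ?F0" using that cone by auto
    show ?thesis
    proof (cases "?F0 = {}")
      case True
      then show ?thesis using F by (simp add: T B_def empty join_tree_def)
    next
      case False
      obtain X where X: "source W S Q \<rho> X" using source_exists[OF False] by blast
      then have "P = shift_cone X"
        unfolding P_def using source_ConsI(1)[OF q Q \<rho> X] by (intro greedy_eq_source[OF qQ \<rho>])
      then show ?thesis using F join_shift_tree_source_tree[OF Q \<rho> X] by (simp add: T B_def)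
    qed
  qed
  show "pverts A \<inter> pverts B = {} \<and>
      P = {1} \<union> shift (positive_greedy_facet W S Q \<rho>) \<and>
      T = \<lparr>pverts = pverts A \<union> pverts B, parcs = parcs A \<union> parcs B \<union> {(P, R)}\<rparr>"
    if "\<not> (\<forall>I\<in>F. 1 \<notin> I)" "\<not> (\<forall>I\<in>F. 1 \<in> I)"
  proof -
    have F0: "?F0 \<noteq> {}" using that(1) cone by auto
    obtain X where X: "source W S Q \<rho> X" using source_exists[OF F0] by blast
    have less: "len (q \<otimes> \<rho>) < len \<rho>" and F1: "?F1 \<noteq> {}"
      using that(2) base by (auto split: if_splits)
    obtain Y where Y: "source W S Q (q \<otimes> \<rho>) Y" using source_exists[OF F1] by blast
    have base': "{I \<in> F. 1 \<notin> I} = shift ` ?F1" using base less by simp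
    have P: "P = shift_cone X"
      unfolding P_def using source_ConsI(1)[OF q Q \<rho> X] by (intro greedy_eq_source[OF qQ \<rho>])
    have R: "R = shift Y" unfolding R_def using greedy_eq_source[OF Q q\<rho> Y] by simp
    have A: "A = \<lparr>pverts = {I \<in> F. 1 \<notin> I}, parcs = rising_arcs {I \<in> F. 1 \<notin> I} R\<rparr>"
      using shift_tree_source_tree[OF Q q\<rho> Y] by (simp add: A_def base' R)
    have B: "B = \<lparr>pverts = {I \<in> F. 1 \<in> I}, parcs = rising_arcs {I \<in> F. 1 \<in> I} P\<rparr>"
      using join_shift_tree_source_tree[OF Q \<rho> X] by (simp add: B_def cone P)
    note flip = source_flip_first[OF q Q \<rho> less X Y]
    \<comment> \<open>The new arc is (P, R), the unique flip supplied by
      \<open>source_flip_first\<close>.\<close>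
    have "rising_arcs F P =
      rising_arcs {I \<in> F. 1 \<notin> I} R \<union> rising_arcs {I \<in> F. 1 \<in> I} P \<union> {(P, R)}"
    proof (rule rising_arcs_split)
      show "1 \<le> x" if "Z \<in> F" "x \<in> Z" for Z x
        using that unfolding F_def by (rule facet_ge_1)
      have "P \<in> {I \<in> F. 1 \<in> I}" unfolding cone using X by (auto simp: source_def P)
      then show "P \<in> F" "1 \<in> P" by auto
      have "R \<in> {I \<in> F. 1 \<notin> I}" unfolding base' using Y by (auto simp: source_def R)
      then show "R \<in> F" "1 \<notin> R" by auto
      show "flips_up P R" using flip[of Y] Y by (simp add: P R source_def)
      show "Z = R" if "Z \<in> F" "1 \<notin> Z" "flips_up P Z" for Z
      proof -
        have "Z \<in> shift ` ?F1" using that base' by blast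
        then show ?thesis using that flip by (auto simp: P R)
      qed
    qed
    then show ?thesis
      using P greedy_eq_source[OF Q \<rho> X] split by (auto simp: T A B)
  qed
qed

end

theorem proposition4p18:
  fixes W :: "('a, 'b) monoid_scheme" and S :: "'a set" and Q :: "'a list" and \<rho> :: 'a
  assumes "finite_coxeter_system W S"
    and "set Q \<subseteq> S" and "Q \<noteq> []"
    and "\<rho> \<in> carrier W"
  shows
    "((\<forall>I\<in>facets W S Q \<rho>. 1 \<notin> I) \<longrightarrow>
        positive_source_tree W S Q \<rho> =
          shift_tree (positive_source_tree W S (tl Q) (hd Q \<otimes>\<^bsub>W\<^esub> \<rho>))) \<and>
     ((\<forall>I\<in>facets W S Q \<rho>. 1 \<in> I) \<longrightarrow>
        positive_source_tree W S Q \<rho> =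
          1 \<star> shift_tree (positive_source_tree W S (tl Q) \<rho>)) \<and>
     (\<not> (\<forall>I\<in>facets W S Q \<rho>. 1 \<notin> I) \<and> \<not> (\<forall>I\<in>facets W S Q \<rho>. 1 \<in> I) \<longrightarrow>
        (let A = shift_tree (positive_source_tree W S (tl Q) (hd Q \<otimes>\<^bsub>W\<^esub> \<rho>));
             B = 1 \<star> shift_tree (positive_source_tree W S (tl Q) \<rho>);
             P = positive_greedy_facet W S Q \<rho>;
             R = shift (positive_greedy_facet W S (tl Q) (hd Q \<otimes>\<^bsub>W\<^esub> \<rho>))
         in pverts A \<inter> pverts B = {} \<and>
            P = {1} \<union> shift (positive_greedy_facet W S (tl Q) \<rho>) \<and>
            positive_source_tree W S Q \<rho> =
              \<lparr>pverts = pverts A \<union> pverts B, parcs = parcs A \<union> parcs B \<union> {(P, R)}\<rparr>))"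
proof -
  have "coxeter_system W S" using assms(1) by (simp add: finite_coxeter_system_def)
  then interpret coxeter W S
    by (intro coxeter.intro coxeter_axioms.intro) (simp_all add: coxeter_system_def)
  obtain q Q' where Q: "Q = q # Q'" using assms(3) by (cases Q) auto
  then have "q \<in> S" "set Q' \<subseteq> S" using assms(2) by auto
  note C = source_tree_Cons[OF this assms(4)]
  show ?thesis
    unfolding Q list.sel Let_def using C by blast
qed

end
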